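(* Let $P(\lambda)=P_0+P_1\lambda+\cdots+P_d\lambda^d\in\mathbb{C}[\lambda]^{m\times m}$ be a polynomial matrix of degree $d>1$ with a Hermitian, skew-Hermitian, para-Hermitian or para-skew-Hermitian structure. Let $T$ and $L_s(\lambda)$ be the block Hankel matrix and the pencil associated with $P(\lambda)$ defined in the context, let $r=\operatorname{rank}T$, and let $S:=\operatorname{diag}((-1)^{d-1}I_m,\ldots,(-1)^2I_m,-I_m)\in\mathbb{C}^{m(d-1)\times m(d-1)}$. Let $U,V\in\mathbb{C}^{m(d-1)\times m(d-1)}$ be unitary matrices such that $U^*TV=\begin{bmatrix}0&0\\0&\widehat T\end{bmatrix}$ with $\widehat T\in\mathbb{C}^{r\times r}$ invertible, where $U=V$ in the Hermitian and skew-Hermitian cases, and $U=SV$ in the para-Hermitian and para-skew-Hermitian cases. Let $$\widehat L_s(\lambda):=\left[\begin{array}{c|c}\widehat A_s(\lambda)&-\widehat B_s(\lambda)\\ \hline \widehat C_s(\lambda)&\widehat D_s(\lambda)\end{array}\right],\qquad \widehat A_s(\lambda)\in\mathbb{C}[\lambda]^{r\times r},$$ be the pencil obtained from $\operatorname{diag}(U^*,I_m)\,L_s(\lambda)\,\operatorname{diag}(V,I_m)$ by deleting its first $m(d-1)-r$ rows and its first $m(d-1)-r$ columns (which are zero). Then $\widehat L_s(\lambda)$ is a strongly minimal linearization of $P(\lambda)$ with the same self-conjugate structure as $P(\lambda)$.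
   Context: **Self-conjugate structures.** A square rational matrix (in particular a polynomial matrix or pencil) $M(\lambda)$ is: Hermitian if $[M(\lambda)]^*=M(\overline\lambda)$; skew-Hermitian if $[M(\lambda)]^*=-M(\overline\lambda)$; para-Hermitian if $[M(\lambda)]^*=M(-\overline\lambda)$; para-skew-Hermitian if $[M(\lambda)]^*=-M(-\overline\lambda)$. Here $^*$ is the conjugate transpose; for a polynomial matrix, $[P(\lambda)]^*=P_0^*+P_1^*\overline\lambda+\cdots+P_d^*\overline\lambda^d$. **Block Hankel matrix and pencil of a polynomial matrix.** For $P(\lambda)=P_0+P_1\lambda+\cdots+P_d\lambda^d\in\mathbb{C}[\lambda]^{m\times m}$ with $d>1$, set $P_k:=0$ for $k>d$. * $T\in\mathbb{C}^{m(d-1)\times m(d-1)}$ is the $(d-1)\times(d-1)$ block matrix whose $(i,j)$ block ($1\le i,j\le d-1$) is $P_{2d-i-j}$. * $L_s(\lambda)=\begin{bmatrix}A_s(\lambda)&-B_s(\lambda)\\C_s(\lambda)&D_s(\lambda)\end{bmatrix}\in\mathbb{C}[\lambda]^{md\times md}$, where $A_s(\lambda)$ is the $(d-1)\times(d-1)$ block matrix with $(i,j)$ block $\lambda P_{2d+1-i-j}-P_{2d-i-j}$; $-B_s(\lambda)$ is the block column with blocks (top to bottom) $\lambda P_d,\lambda P_{d-1},\ldots,\lambda P_2$; $C_s(\lambda)$ is the block row with blocks (left to right) $\lambda P_d,\lambda P_{d-1},\ldots,\lambda P_2$; and $D_s(\lambda)=\lambda P_1+P_0$. **Strongly minimal linearization.**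 A square polynomial matrix is regular if its determinant is not identically zero. A linear polynomial system matrix is a block-partitioned pencil $$L(\lambda)=\begin{bmatrix}A(\lambda)&-B(\lambda)\\C(\lambda)&D(\lambda)\end{bmatrix}=\begin{bmatrix}\lambda A_1-A_0&-\lambda B_1+B_0\\ \lambda C_1-C_0&\lambda D_1-D_0\end{bmatrix}\in\mathbb{C}[\lambda]^{(p+m)\times(p+n)}$$ with $A(\lambda)\in\mathbb{C}[\lambda]^{p\times p}$ regular; its transfer function matrix is $D(\lambda)+C(\lambda)A(\lambda)^{-1}B(\lambda)$. It is strongly minimal if the pencils $[A(\lambda)\ \ -B(\lambda)]$ and $\begin{bmatrix}A(\lambda)\\C(\lambda)\end{bmatrix}$ have degree exactly 1 and no finite or infinite eigenvalues; that is, for every $\lambda_0\in\mathbb{C}$ the matrices $[A(\lambda_0)\ \ -B(\lambda_0)]$ and $\begin{bmatrix}A(\lambda_0)\\C(\lambda_0)\end{bmatrix}$ have rank $p$, and $[A_1\ \ -B_1]$ and $\begin{bmatrix}A_1\\C_1\end{bmatrix}$ have rank $p$. $L(\lambda)$ is a strongly minimal linearization of a rational matrix $R(\lambda)\in\mathbb{C}(\lambda)^{m\times n}$ if it is strongly minimal and its transfer function matrix is $R(\lambda)$. *)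

theory Defs
  imports
    "HOL-Computational_Algebra.Computational_Algebra"
    "Jordan_Normal_Form.Schur_Decomposition"
    "Jordan_Normal_Form.Gauss_Jordan_Elimination"
    "Jordan_Normal_Form.DL_Rank"
begin

section \<open>Polynomial matrices\<close>

definition coeff_mat :: "'a::zero poly mat \<Rightarrow> nat \<Rightarrow> 'a mat" where
  "coeff_mat M k = map_mat (\<lambda>q. coeff q k) M"

definition eval_mat :: "'a::comm_semiring_0 poly mat \<Rightarrow> 'a \<Rightarrow> 'a mat" where
  "eval_mat M z = map_mat (\<lambda>q. poly q z) M"

definition const_pmat :: "'a::zero mat \<Rightarrow> 'a poly mat" where
  "const_pmat M = map_mat (\<lambda>c. [:c:]) M"

abbreviation lambda_times :: "'a::comm_semiring_1 mat \<Rightarrow> 'a poly mat" where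
  "lambda_times M \<equiv> [:0, 1:] \<cdot>\<^sub>m const_pmat M"

definition has_degree :: "'a::zero poly mat \<Rightarrow> nat \<Rightarrow> bool" where
  "has_degree M d \<longleftrightarrow>
     coeff_mat M d \<noteq> 0\<^sub>m (dim_row M) (dim_col M) \<and>
     (\<forall>k>d. coeff_mat M k = 0\<^sub>m (dim_row M) (dim_col M))"

definition regular_pmat :: "'a::idom poly mat \<Rightarrow> bool" where
  "regular_pmat M \<longleftrightarrow> square_mat M \<and> det M \<noteq> 0"

definition rational_mat :: "'a::field poly mat \<Rightarrow> 'a poly fract mat" where
  "rational_mat M = map_mat (\<lambda>q. Fract q 1) M"

section \<open>Self-conjugate structures\<close>

datatype self_conjugate_structure =
  Hermitian | Skew_Hermitian | Para_Hermitian | Para_Skew_Hermitian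

text \<open>The conjugate transpose of \<open>M(z)\<close> as a matrix of complex numbers is
  \<open>P\<^sub>0\<^sup>* + P\<^sub>1\<^sup>* (cnj z) + \<dots> + P\<^sub>d\<^sup>* (cnj z)^d\<close>.
  Equality of matrices includes equality of dimensions, so \<open>M\<close> is square in each case.\<close>

fun has_structure :: "self_conjugate_structure \<Rightarrow> complex poly mat \<Rightarrow> bool" where
  "has_structure Hermitian M \<longleftrightarrow>
     (\<forall>z. mat_adjoint (eval_mat M z) = eval_mat M (cnj z))"
| "has_structure Skew_Hermitian M \<longleftrightarrow>
     (\<forall>z. mat_adjoint (eval_mat M z) = - eval_mat M (cnj z))"
| "has_structure Para_Hermitian M \<longleftrightarrow>
     (\<forall>z. mat_adjoint (eval_mat M z) = eval_mat M (- cnj z))"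
| "has_structure Para_Skew_Hermitian M \<longleftrightarrow>
     (\<forall>z. mat_adjoint (eval_mat M z) = - eval_mat M (- cnj z))"

definition unitary_mat :: "nat \<Rightarrow> complex mat \<Rightarrow> bool" where
  "unitary_mat n U \<longleftrightarrow>
     U \<in> carrier_mat n n \<and> mat_adjoint U * U = 1\<^sub>m n \<and> U * mat_adjoint U = 1\<^sub>m n"

section \<open>The block Hankel matrix and the pencil\<close>

text \<open>The matrix with \<open>p \<times> q\<close> blocks of size \<open>m \<times> m\<close>; the block indices passed to
  \<open>F\<close> start at 1.\<close>

definition block_mat :: "nat \<Rightarrow> nat \<Rightarrow> nat \<Rightarrow> (nat \<Rightarrow> nat \<Rightarrow> 'a mat) \<Rightarrow> 'a mat" where
  "block_mat m p q F =
     mat (m * p) (m * q) (\<lambda>(i, j). F (i div m + 1) (j div m + 1) $$ (i mod m, j mod m))"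

text \<open>Since \<open>coeff_mat P k\<close> vanishes above the degree, the convention \<open>P\<^sub>k = 0\<close> for
  \<open>k > d\<close> is automatic below. The block indices are at most \<open>d - 1\<close>, so no subtraction of
  natural numbers is truncated.\<close>

definition hankel_T :: "nat \<Rightarrow> nat \<Rightarrow> complex poly mat \<Rightarrow> complex mat" where
  "hankel_T m d P = block_mat m (d - 1) (d - 1) (\<lambda>i j. coeff_mat P (2 * d - i - j))"

definition pencil_Ls :: "nat \<Rightarrow> nat \<Rightarrow> complex poly mat \<Rightarrow> complex poly mat" where
  "pencil_Ls m d P = four_block_mat
     (block_mat m (d - 1) (d - 1) (\<lambda>i j.
        lambda_times (coeff_mat P (2 * d + 1 - i - j)) - const_pmat (coeff_mat P (2 * d - i - j))))
     (block_mat m (d - 1) 1 (\<lambda>i _. lambda_times (coeff_mat P (d + 1 - i))))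
     (block_mat m 1 (d - 1) (\<lambda>_ j. lambda_times (coeff_mat P (d + 1 - j))))
     (lambda_times (coeff_mat P 1) + const_pmat (coeff_mat P 0))"

text \<open>\<open>diag((-1)^(d-1) I\<^sub>m, \<dots>, (-1)\<^sup>2 I\<^sub>m, -I\<^sub>m)\<close>: the \<open>i\<close>-th block,
  \<open>i = 1, \<dots>, d - 1\<close>, is \<open>(-1)^(d-i) I\<^sub>m\<close>.\<close>

definition sign_S :: "nat \<Rightarrow> nat \<Rightarrow> complex mat" where
  "sign_S m d = block_mat m (d - 1) (d - 1)
     (\<lambda>i j. if i = j then (-1) ^ (d - i) \<cdot>\<^sub>m 1\<^sub>m m else 0\<^sub>m m m)"

definition transformed_pencil ::
  "nat \<Rightarrow> complex mat \<Rightarrow> complex mat \<Rightarrow> complex poly mat \<Rightarrow> complex poly mat" where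
  "transformed_pencil m U V L =
     const_pmat (diag_block_mat [mat_adjoint U, 1\<^sub>m m]) * L * const_pmat (diag_block_mat [V, 1\<^sub>m m])"

definition delete_leading :: "nat \<Rightarrow> 'a mat \<Rightarrow> 'a mat" where
  "delete_leading k M = mat (dim_row M - k) (dim_col M - k) (\<lambda>(i, j). M $$ (i + k, j + k))"

section \<open>Strongly minimal linearizations\<close>

definition append_cols :: "'a::zero mat \<Rightarrow> 'a mat \<Rightarrow> 'a mat" where
  "append_cols A B = four_block_mat A B (0\<^sub>m 0 (dim_col A)) (0\<^sub>m 0 (dim_col B))"

definition linear_system_matrix ::
  "nat \<Rightarrow> nat \<Rightarrow> nat \<Rightarrow> complex poly mat \<Rightarrow> bool" where
  "linear_system_matrix p m n L \<longleftrightarrow>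
     L \<in> carrier_mat (p + m) (p + n) \<and>
     (\<forall>k>1. coeff_mat L k = 0\<^sub>m (p + m) (p + n)) \<and>
     (case split_block L p p of (A, mB, C, D) \<Rightarrow> regular_pmat A)"

text \<open>The upper right block of a system matrix is \<open>-B\<close>. For a regular \<open>A\<close>, the
  value of \<open>mat_inverse\<close> is \<open>Some\<close> of the inverse over the field of rational functions.\<close>

definition transfer_function :: "nat \<Rightarrow> complex poly mat \<Rightarrow> complex poly fract mat" where
  "transfer_function p L = (case split_block L p p of (A, mB, C, D) \<Rightarrow>
     rational_mat D + rational_mat C * the (mat_inverse (rational_mat A)) * rational_mat (- mB))"

definition strongly_minimal ::
  "nat \<Rightarrow> nat \<Rightarrow> nat \<Rightarrow> complex poly mat \<Rightarrow> bool" where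
  "strongly_minimal p m n L \<longleftrightarrow>
     linear_system_matrix p m n L \<and>
     (case split_block L p p of (A, mB, C, D) \<Rightarrow>
        has_degree (append_cols A mB) 1 \<and>
        has_degree (A @\<^sub>r C) 1 \<and>
        (\<forall>z. vec_space.rank p (eval_mat (append_cols A mB) z) = p) \<and>
        (\<forall>z. vec_space.rank (p + m) (eval_mat (A @\<^sub>r C) z) = p) \<and>
        vec_space.rank p (coeff_mat (append_cols A mB) 1) = p \<and>
        vec_space.rank (p + m) (coeff_mat (A @\<^sub>r C) 1) = p)"

text \<open>\<open>p\<close> is the size of the block \<open>A\<close> of the partitioned pencil \<open>L\<close>, and \<open>R\<close> is an
  \<open>m \<times> n\<close> rational matrix.\<close>

definition strongly_minimal_linearization ::
  "nat \<Rightarrow> nat \<Rightarrow> nat \<Rightarrow> complex poly mat \<Rightarrow> complex poly fract mat \<Rightarrow> bool" where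
  "strongly_minimal_linearization p m n L R \<longleftrightarrow>
     R \<in> carrier_mat m n \<and> strongly_minimal p m n L \<and> transfer_function p L = R"

end

theory Submission
  imports Defs
begin

text \<open>With the block down shift \<open>N\<close> and the last block column \<open>E\<close> of the identity, the Hankel
  structure reads \<open>N T = T N\<^sup>*\<close>, and
  \<open>L\<^sub>s(z) = [(z N - I) T, z T E; z E\<^sup>* T, z P\<^sub>1 + P\<^sub>0]\<close>. Writing \<open>T = U\<^sub>2 T' V\<^sub>2\<^sup>*\<close>, where
  \<open>U\<^sub>2\<close>, \<open>V\<^sub>2\<close> consist of the last \<open>r\<close> columns of \<open>U\<close>, \<open>V\<close>, the relation
  \<open>N T = T N\<^sup>*\<close> makes the range of \<open>T\<close> invariant under \<open>N\<close> and its kernel invariant under \<open>N\<^sup>*\<close>.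
  Since \<open>N\<close> is nilpotent, the compression of \<open>(z N - I) T\<close> is invertible for every \<open>z\<close>, and
  \<open>N\<^sup>* N + E E\<^sup>* = I\<close> yields one-sided inverses of the leading coefficients. For the transfer
  function, the polynomial column \<open>F\<close> with blocks \<open>z^(d-1) I, \<dots>, z I\<close> satisfies
  \<open>(z N\<^sup>* - I) F = - z E\<close>, so that \<open>V\<^sub>2\<^sup>* F\<close> solves the compressed system.
  All four structures take the form \<open>P(z)\<^sup>* = \<epsilon> P(\<sigma> (cnj z))\<close> with signs \<open>\<epsilon>\<close>, \<open>\<sigma>\<close>, and
  \<open>diag(\<sigma>^(d-1) I, \<dots>, \<sigma> I)\<close> is the identity or \<open>S\<close>.\<close>

section \<open>One-sided inverses and rank\<close>

text \<open>The matrix laws get premises on dimensions instead of carrier sets, so that they can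
  serve as rewrite rules; products are normalized by bracketing to the right.\<close>

lemma mult_mat_assoc:
  fixes A B C :: "'a::semiring_0 mat"
  shows "dim_col A = dim_row B \<Longrightarrow> dim_col B = dim_row C \<Longrightarrow> A * B * C = A * (B * C)"
  by (rule assoc_mult_mat[of _ "dim_row A" "dim_row B" _ "dim_row C" _ "dim_col C"]) auto

lemma add_mult_distrib_dim:
  fixes A B C :: "'a::semiring_0 mat"
  shows "dim_row A = dim_row B \<Longrightarrow> dim_col A = dim_col B \<Longrightarrow> dim_col A = dim_row C \<Longrightarrow>
    (A + B) * C = A * C + B * C"
  by (rule add_mult_distrib_mat[of _ "dim_row A" "dim_row C" _ _ "dim_col C"]) auto

lemma mult_add_distrib_dim:
  fixes A B C :: "'a::semiring_0 mat"
  shows "dim_row B = dim_row C \<Longrightarrow> dim_col B = dim_col C \<Longrightarrow> dim_col A = dim_row C \<Longrightarrow>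
    A * (B + C) = A * B + A * C"
  by (rule mult_add_distrib_mat[of _ "dim_row A" "dim_row C" _ "dim_col C"]) auto

lemma minus_mult_distrib_dim:
  fixes A B C :: "'a::ring mat"
  shows "dim_row A = dim_row B \<Longrightarrow> dim_col A = dim_col B \<Longrightarrow> dim_col A = dim_row C \<Longrightarrow>
    (A - B) * C = A * C - B * C"
  by (rule minus_mult_distrib_mat[of _ "dim_row A" "dim_row C" _ _ "dim_col C"]) auto

lemma mult_minus_distrib_dim:
  fixes A B C :: "'a::ring mat"
  shows "dim_row B = dim_row C \<Longrightarrow> dim_col B = dim_col C \<Longrightarrow> dim_col A = dim_row C \<Longrightarrow>
    A * (B - C) = A * B - A * C"
  by (rule mult_minus_distrib_mat[of _ "dim_row A" "dim_row C" _ "dim_col C"]) auto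

lemma mult_smult_dim:
  fixes A B :: "'a::comm_semiring_0 mat"
  shows "dim_col A = dim_row B \<Longrightarrow> A * (c \<cdot>\<^sub>m B) = c \<cdot>\<^sub>m (A * B)"
  by (rule mult_smult_distrib[of _ "dim_row A" "dim_row B" _ "dim_col B"]) auto

lemma smult_mult_dim:
  fixes A B :: "'a::comm_semiring_0 mat"
  shows "dim_col A = dim_row B \<Longrightarrow> (c \<cdot>\<^sub>m A) * B = c \<cdot>\<^sub>m (A * B)"
  by (rule mult_smult_assoc_mat[of _ "dim_row A" "dim_row B" _ "dim_col B"]) auto

lemma one_mult_dim: "dim_row A = k \<Longrightarrow> 1\<^sub>m k * A = (A :: 'a::semiring_1 mat)"
  by (rule left_mult_one_mat') auto

lemma mult_one_dim: "dim_col A = k \<Longrightarrow> A * 1\<^sub>m k = (A :: 'a::semiring_1 mat)"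
  by (rule right_mult_one_mat') auto

lemmas mat_dim_simps = mult_mat_assoc add_mult_distrib_dim mult_add_distrib_dim
  minus_mult_distrib_dim mult_minus_distrib_dim mult_smult_dim smult_mult_dim
  one_mult_dim mult_one_dim

text \<open>Writing \<open>y = A (Y y)\<close> puts every vector into the column space.\<close>

lemma rank_eq_dim_rowI:
  fixes A :: "'a::field mat"
  assumes A: "A \<in> carrier_mat n nc" and Y: "Y \<in> carrier_mat nc n" and AY: "A * Y = 1\<^sub>m n"
  shows "vec_space.rank n A = n"
proof -
  interpret vec_space "TYPE('a)" n .
  have "y \<in> col_space A" if y: "y \<in> carrier_vec n" for y
  proof -
    have "A *\<^sub>v (Y *\<^sub>v y) = y"
      by (simp only: assoc_mult_mat_vec[OF A Y y, symmetric] AY one_mult_mat_vec[OF y])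
    moreover have "Y *\<^sub>v y \<in> carrier_vec (dim_col A)" using A Y y by simp
    moreover have "y \<in> carrier_vec (dim_row A)" using A y by simp
    ultimately show ?thesis unfolding col_space_eq[OF A] by blast
  qed
  moreover have "col_space A \<subseteq> carrier_vec n" using A unfolding col_space_eq[OF A] by auto
  ultimately have "span (set (cols A)) = carrier V" unfolding col_space_def by auto
  then have "vectorspace.dim class_ring (vs (span (set (cols A)))) = dim"
    by (simp add: module_vec_def)
  then show ?thesis by (simp only: rank_def dim_is_n)
qed

text \<open>A left inverse makes multiplication by \<open>A\<close> injective, which amounts to
  linear independence of the columns.\<close>

lemma rank_eq_dim_colI:
  fixes A :: "'a::field mat"
  assumes A: "A \<in> carrier_mat n nc" and Y: "Y \<in> carrier_mat nc n" and YA: "Y * A = 1\<^sub>m nc"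
  shows "vec_space.rank n A = nc"
proof -
  interpret vec_space "TYPE('a)" n .
  have Y_A: "Y *\<^sub>v (A *\<^sub>v v) = v" if "v \<in> carrier_vec nc" for v
    by (simp only: assoc_mult_mat_vec[OF Y A that, symmetric] YA one_mult_mat_vec[OF that])
  have inj: "v = w" if "v \<in> carrier_vec nc" "w \<in> carrier_vec nc" "A *\<^sub>v v = A *\<^sub>v w" for v w
    using arg_cong[OF that(3), of "\<lambda>u. Y *\<^sub>v u"] unfolding Y_A[OF that(1)] Y_A[OF that(2)] .
  \<comment> \<open>Independence concerns the set of columns, so repetitions are excluded first:
    equal columns would be equal images of different unit vectors.\<close>
  have dist: "distinct (cols A)"
  proof (unfold distinct_conv_nth, intro allI impI notI)
    fix i j assume ij: "i < length (cols A)" "j < length (cols A)" "i \<noteq> j" "cols A ! i = cols A ! j"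
    then have ij': "i < nc" "j < nc" "col A i = col A j" using A by simp_all
    have unit: "A *\<^sub>v unit_vec nc l = col A l" if "l < nc" for l
      using A that by (intro eq_vecI) simp_all
    have "A *\<^sub>v unit_vec nc i = A *\<^sub>v unit_vec nc j"
      unfolding unit[OF ij'(1)] unit[OF ij'(2)] by (rule ij'(3))
    then have "unit_vec nc i = (unit_vec nc j :: 'a vec)" by (rule inj[rotated 2]) simp_all
    from arg_cong[OF this, of "\<lambda>v. vec_index v i"] show False using ij ij' by simp
  qed
  moreover have "lin_indpt (set (cols A))"
  proof
    assume dep: "lin_dep (set (cols A))"
    obtain v where v: "v \<in> carrier_vec nc" "v \<noteq> 0\<^sub>v nc" "A *\<^sub>v v = 0\<^sub>v n"
      by (rule lin_depE[OF A dep dist])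
    have "v = 0\<^sub>v nc"
      by (rule inj[OF v(1) zero_carrier_vec], unfold v(3)) (rule eq_vecI, use A in simp_all)
    then show False using v by simp
  qed
  ultimately show ?thesis by (rule lin_indpt_full_rank[OF A])
qed

section \<open>Compression to the range of a Hankel matrix\<close>

text \<open>\<open>Uh\<close>, \<open>Vh\<close>, \<open>Nt\<close> and \<open>Et\<close> stand for the adjoints of \<open>U\<close>, \<open>V\<close>, \<open>N\<close> and \<open>E\<close>.\<close>

locale compressed_pencil =
  fixes n m r :: nat and N Nt T E Et U Uh V Vh Th Ti :: "complex mat"
  assumes carrier: "N \<in> carrier_mat n n" "Nt \<in> carrier_mat n n" "T \<in> carrier_mat n n"
      "E \<in> carrier_mat n m" "Et \<in> carrier_mat m n"
      "U \<in> carrier_mat n r" "Uh \<in> carrier_mat r n" "V \<in> carrier_mat n r" "Vh \<in> carrier_mat r n"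
      "Th \<in> carrier_mat r r" "Ti \<in> carrier_mat r r"
    and iso: "Uh * U = 1\<^sub>m r" "Vh * V = 1\<^sub>m r"
    and inv: "Th * Ti = 1\<^sub>m r" "Ti * Th = 1\<^sub>m r"
    and T_eq: "T = U * (Th * Vh)"
    and shift: "N * T = T * Nt"
    and shift_one: "Nt * N + E * Et = 1\<^sub>m n"
    and resolvent: "\<exists>K \<in> carrier_mat n n. (z \<cdot>\<^sub>m Nt - 1\<^sub>m n) * K = 1\<^sub>m n"
begin

lemmas dims [simp] = carrier[THEN carrier_matD(1)] carrier[THEN carrier_matD(2)]

text \<open>The trailing factor \<open>X\<close> lets the relations apply inside products bracketed
  to the right.\<close>

lemma cancel:
  assumes "dim_row X = r"
  shows "Uh * (U * X) = X" "Vh * (V * X) = X" "Th * (Ti * X) = X" "Ti * (Th * X) = X"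
  using assms iso inv by (simp_all flip: mult_mat_assoc add: one_mult_dim)

text \<open>\<open>V * Vh\<close> is idempotent with the same kernel as \<open>T\<close>.\<close>

lemma T_proj: "T * (V * Vh) = T"
  by (simp add: T_eq mult_mat_assoc cancel)

lemma T_V: "T * V = U * Th"
  by (simp add: T_eq mult_mat_assoc iso mult_one_dim)

lemma Uh_T_mult: "dim_row X = n \<Longrightarrow> Uh * (T * X) = Th * (Vh * X)"
  by (simp add: T_eq mult_mat_assoc cancel)

lemma Vh_eq: "Vh = Ti * (Uh * T)"
  by (simp add: T_eq mult_mat_assoc cancel)

lemma U_eq: "U = T * (V * Ti)"
  by (simp add: T_eq mult_mat_assoc cancel inv mult_one_dim)

text \<open>The kernel of \<open>T\<close>, which is that of \<open>Vh\<close>, is invariant under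
  \<open>Nt\<close>: \<open>T x = 0\<close> gives \<open>T (Nt x) = N (T x) = 0\<close>. So
  \<open>Vh * Nt\<close> annihilates whatever the projection \<open>V * Vh\<close> removes.\<close>

lemma Vh_Nt_proj: "Vh * (Nt * (V * Vh)) = Vh * Nt"
proof -
  have "Vh * Nt = Ti * (Uh * (N * T))" by (simp add: Vh_eq mult_mat_assoc shift)
  moreover have "Vh * (Nt * (V * Vh)) = Ti * (Uh * (T * (Nt * (V * Vh))))"
    by (subst Vh_eq) (simp add: mult_mat_assoc)
  moreover have "T * (Nt * (V * Vh)) = N * (T * (V * Vh))"
    by (simp flip: mult_mat_assoc add: shift)
  ultimately show ?thesis by (simp add: T_proj)
qed

text \<open>The range of \<open>T\<close>, which is that of \<open>U\<close>, is invariant under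
  \<open>N\<close> because \<open>N T = T Nt\<close>, and \<open>U * Uh\<close> acts as the identity
  on it.\<close>

lemma proj_N_U: "U * (Uh * (N * U)) = N * U"
proof -
  have "N * U = N * T * (V * Ti)" by (subst U_eq) (simp add: mult_mat_assoc)
  also have "\<dots> = T * (Nt * (V * Ti))" by (simp add: shift mult_mat_assoc)
  finally have NU: "N * U = T * (Nt * (V * Ti))" .
  show ?thesis unfolding NU by (simp add: T_eq mult_mat_assoc cancel)
qed

text \<open>The shift relation gives \<open>z N T - T = T (z Nt - 1)\<close>, and
  \<open>Uh T = Th Vh\<close>, so the block is \<open>Th\<close> times the compression of
  \<open>z Nt - 1\<close>. Kernel invariance allows the resolvent to be compressed along with
  it.\<close>

lemma compressed_invertible:
  obtains X where "X \<in> carrier_mat r r" "(Uh * (z \<cdot>\<^sub>m (N * T) - T) * V) * X = 1\<^sub>m r"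
    "X * (Uh * (z \<cdot>\<^sub>m (N * T) - T) * V) = 1\<^sub>m r"
proof -
  obtain K where K: "K \<in> carrier_mat n n" "(z \<cdot>\<^sub>m Nt - 1\<^sub>m n) * K = 1\<^sub>m n" using resolvent by blast
  have [simp]: "dim_row K = n" "dim_col K = n" using K by auto
  let ?Z = "z \<cdot>\<^sub>m Nt - 1\<^sub>m n"
  \<comment> \<open>The compressed resolvent inverts the compression of \<open>?Z\<close>, and
    \<open>Ti\<close> undoes \<open>Th\<close>.\<close>
  let ?X = "Vh * (K * (V * Ti))"
  have A: "Uh * (z \<cdot>\<^sub>m (N * T) - T) * V = Th * (Vh * (?Z * V))"
  proof -
    have "z \<cdot>\<^sub>m (N * T) - T = T * ?Z" by (simp add: shift mat_dim_simps)
    then show ?thesis by (simp add: T_eq mult_mat_assoc cancel)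
  qed
  \<comment> \<open>Kernel invariance removes the projection between the two compressions, so that
    \<open>?Z\<close> meets \<open>K\<close> directly.\<close>
  have Z: "Vh * (?Z * (V * Vh)) = Vh * ?Z"
    by (simp add: mat_dim_simps Vh_Nt_proj cancel)
  have "Th * (Vh * (?Z * V)) * ?X = Th * ((Vh * (?Z * (V * Vh))) * (K * (V * Ti)))"
    by (simp add: mult_mat_assoc)
  also have "\<dots> = Th * (Vh * ((?Z * K) * (V * Ti)))"
    unfolding Z by (simp add: mult_mat_assoc)
  also have "\<dots> = 1\<^sub>m r" unfolding K by (simp add: one_mult_dim cancel inv)
  finally have 1: "(Uh * (z \<cdot>\<^sub>m (N * T) - T) * V) * ?X = 1\<^sub>m r" unfolding A .
  have "?X * (Uh * (z \<cdot>\<^sub>m (N * T) - T) * V) = 1\<^sub>m r"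
    by (rule mat_mult_left_right_inverse[OF _ _ 1]) auto
  then show ?thesis using 1 by (intro that[of ?X]) auto
qed

text \<open>The coefficients of \<open>z\<close> in the compressed \<open>A\<close> and
  \<open>-B\<close> equal \<open>Th Vh Nt V\<close> and \<open>Th Vh E\<close>. Kernel invariance
  removes the projection between \<open>Nt\<close> and \<open>N\<close>, and
  \<open>Nt N + E Et = 1\<close> collapses the sum to \<open>Th Ti\<close>.\<close>

lemma leading_right_inverse:
  "(Uh * (N * T) * V) * (Vh * N * V * Ti) + (Uh * (T * E)) * (Et * V * Ti) = 1\<^sub>m r"
proof -
  have "(Uh * (N * T) * V) * (Vh * N * V * Ti) = Th * ((Vh * (Nt * (V * Vh))) * (N * (V * Ti)))"
    by (simp add: shift mult_mat_assoc Uh_T_mult)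
  also have "\<dots> = Th * (Vh * ((Nt * N) * (V * Ti)))"
    unfolding Vh_Nt_proj by (simp add: mult_mat_assoc)
  finally have "(Uh * (N * T) * V) * (Vh * N * V * Ti) + (Uh * (T * E)) * (Et * V * Ti)
      = Th * (Vh * ((Nt * N + E * Et) * (V * Ti)))"
    by (simp add: T_eq mat_dim_simps cancel)
  then show ?thesis unfolding shift_one by (simp add: one_mult_dim cancel inv)
qed

text \<open>The mirror image for \<open>A\<close> over \<open>C\<close>: here
  \<open>T V = U Th\<close>, and range invariance removes the projection \<open>U * Uh\<close> in
  front of \<open>N\<close>.\<close>

lemma leading_left_inverse:
  "(Ti * Uh * Nt * U) * (Uh * (N * T) * V) + (Ti * Uh * E) * (Et * T * V) = 1\<^sub>m r"
proof -
  have "(Ti * Uh * Nt * U) * (Uh * (N * T) * V) = Ti * (Uh * (Nt * ((U * (Uh * (N * U))) * Th)))"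
    by (simp add: T_V mult_mat_assoc)
  also have "\<dots> = Ti * (Uh * ((Nt * N) * (U * Th)))"
    unfolding proj_N_U by (simp add: mult_mat_assoc)
  finally have "(Ti * Uh * Nt * U) * (Uh * (N * T) * V) + (Ti * Uh * E) * (Et * T * V)
      = Ti * (Uh * ((Nt * N + E * Et) * (U * Th)))"
    by (simp add: T_V mat_dim_simps)
  then show ?thesis unfolding shift_one by (simp add: one_mult_dim cancel inv)
qed

end

section \<open>Polynomial matrices and block operations\<close>

lemma dim_eval_mat [simp]:
  "dim_row (eval_mat M z) = dim_row M" "dim_col (eval_mat M z) = dim_col M"
  by (simp_all add: eval_mat_def)

lemma dim_coeff_mat [simp]:
  "dim_row (coeff_mat M k) = dim_row M" "dim_col (coeff_mat M k) = dim_col M"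
  by (simp_all add: coeff_mat_def)

lemma dim_const_pmat [simp]:
  "dim_row (const_pmat M) = dim_row M" "dim_col (const_pmat M) = dim_col M"
  by (simp_all add: const_pmat_def)

lemma dim_block_mat [simp]:
  "dim_row (block_mat m p q F) = m * p" "dim_col (block_mat m p q F) = m * q"
  by (simp_all add: block_mat_def)

lemma eval_const_pmat [simp]: "eval_mat (const_pmat M) z = M"
  by (rule eq_matI) (simp_all add: eval_mat_def const_pmat_def)

lemma eval_mat_mult:
  fixes A B :: "'a::comm_ring_1 poly mat"
  assumes "dim_col A = dim_row B"
  shows "eval_mat (A * B) z = eval_mat A z * eval_mat B z"
  using assms by (intro eq_matI) (simp_all add: eval_mat_def scalar_prod_def poly_sum)

lemma eval_mat_add:
  assumes "dim_row A = dim_row B" "dim_col A = dim_col B"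
  shows "eval_mat (A + B) z = eval_mat A z + eval_mat B z"
  using assms by (intro eq_matI) (simp_all add: eval_mat_def)

lemma eval_mat_uminus:
  fixes A :: "'a::comm_ring poly mat"
  shows "eval_mat (- A) z = - eval_mat A z"
  by (intro eq_matI) (simp_all add: eval_mat_def)

lemma eval_four_block_mat:
  assumes "dim_row B = dim_row A" "dim_col B = dim_col D" "dim_row C = dim_row D" "dim_col C = dim_col A"
  shows "eval_mat (four_block_mat A B C D) z =
    four_block_mat (eval_mat A z) (eval_mat B z) (eval_mat C z) (eval_mat D z)"
  using assms by (intro eq_matI) (simp_all add: eval_mat_def)

lemma coeff_four_block_mat:
  assumes "dim_row B = dim_row A" "dim_col B = dim_col D" "dim_row C = dim_row D" "dim_col C = dim_col A"
  shows "coeff_mat (four_block_mat A B C D) k =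
    four_block_mat (coeff_mat A k) (coeff_mat B k) (coeff_mat C k) (coeff_mat D k)"
  using assms by (intro eq_matI) (simp_all add: coeff_mat_def)

text \<open>A polynomial over an infinite domain is determined by its values, so identities of
  polynomial matrices can be checked pointwise.\<close>

lemma pmat_eqI:
  fixes A B :: "'a::{comm_ring_1,ring_no_zero_divisors,ring_char_0} poly mat"
  assumes "dim_row A = dim_row B" "dim_col A = dim_col B" "\<And>z. eval_mat A z = eval_mat B z"
  shows "A = B"
proof (rule eq_matI)
  fix i j assume ij: "i < dim_row B" "j < dim_col B"
  have "poly (A $$ (i, j)) z = poly (B $$ (i, j)) z" for z
    using arg_cong[OF assms(3)[of z], of "\<lambda>M. M $$ (i, j)"] ij assms(1,2)
    by (simp add: eval_mat_def)
  then show "A $$ (i, j) = B $$ (i, j)" by (simp add: poly_eq_poly_eq_iff[symmetric] fun_eq_iff)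
qed (use assms in simp_all)

text \<open>Agreement at every point with an explicit linear matrix forces equality with it, so
  coefficients can be read off from values.\<close>

lemma coeff_mat_of_eval_linear:
  fixes M :: "'a::{comm_ring_1,ring_no_zero_divisors,ring_char_0} poly mat"
  assumes dims: "A \<in> carrier_mat (dim_row M) (dim_col M)" "B \<in> carrier_mat (dim_row M) (dim_col M)"
    and eval: "\<And>z. eval_mat M z = z \<cdot>\<^sub>m A + B"
  shows "coeff_mat M 1 = A" "k > 1 \<Longrightarrow> coeff_mat M k = 0\<^sub>m (dim_row M) (dim_col M)"
proof -
  have eq: "M = lambda_times A + const_pmat B"
  proof (rule pmat_eqI)
    fix z show "eval_mat M z = eval_mat (lambda_times A + const_pmat B) z"
      unfolding eval using dims by (intro eq_matI) (simp_all add: eval_mat_def const_pmat_def)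
  qed (use dims in simp_all)
  have M: "M $$ (i, j) = [:B $$ (i, j), A $$ (i, j):]" if "i < dim_row M" "j < dim_col M" for i j
    using arg_cong[OF eq, of "\<lambda>X. X $$ (i, j)"] dims that by (simp add: const_pmat_def)
  show "coeff_mat M 1 = A" using dims by (intro eq_matI) (simp_all add: coeff_mat_def M)
  show "k > 1 \<Longrightarrow> coeff_mat M k = 0\<^sub>m (dim_row M) (dim_col M)"
    by (intro eq_matI) (simp_all add: coeff_mat_def M coeff_pCons split: nat.split)
qed

lemma dim_rational_mat [simp]:
  "dim_row (rational_mat M) = dim_row M" "dim_col (rational_mat M) = dim_col M"
  by (simp_all add: rational_mat_def)

lemma rational_mat_mult:
  assumes "dim_col A = dim_row B"
  shows "rational_mat (A * B) = rational_mat A * rational_mat B"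
proof -
  have add: "Fract (p + q) 1 = Fract p 1 + Fract q 1" for p q :: "'a poly" by simp
  have sum: "Fract (sum f S) 1 = (\<Sum>x\<in>S. Fract (f x) 1)" for f :: "nat \<Rightarrow> 'a poly" and S
    by (induction S rule: infinite_finite_induct) (simp_all add: Zero_fract_def add del: add_fract)
  show ?thesis
    using assms by (intro eq_matI) (simp_all add: rational_mat_def scalar_prod_def sum)
qed

lemma rational_mat_add:
  assumes "dim_row A = dim_row B" "dim_col A = dim_col B"
  shows "rational_mat (A + B) = rational_mat A + rational_mat B"
  using assms by (intro eq_matI) (simp_all add: rational_mat_def)

section \<open>Adjoints and block conjugation\<close>

lemma index_mat_adjoint [simp]:
  "i < dim_col A \<Longrightarrow> j < dim_row A \<Longrightarrow> mat_adjoint A $$ (i, j) = conjugate (A $$ (j, i))"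
  by (simp add: mat_adjoint_def mat_of_rows_def)

lemma dim_mat_adjoint [simp]:
  "dim_row (mat_adjoint A) = dim_col A" "dim_col (mat_adjoint A) = dim_row A"
  by (simp_all add: mat_adjoint_def)

lemma mat_adjoint_mult:
  fixes A B :: "complex mat"
  assumes "dim_col A = dim_row B"
  shows "mat_adjoint (A * B) = mat_adjoint B * mat_adjoint A"
  using assms by (intro eq_matI) (simp_all add: scalar_prod_def mult.commute)

lemma mat_adjoint_adjoint [simp]: "mat_adjoint (mat_adjoint A) = A"
  by (rule eq_matI) simp_all

lemma diag_conjugation_four_block:
  fixes A :: "'a::comm_ring_1 mat"
  assumes "dim_col X = dim_row A" "dim_row Y = dim_col A"
    "dim_row B = dim_row A" "dim_col B = m" "dim_row C = m" "dim_col C = dim_col A"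
    "dim_row D = m" "dim_col D = m"
  shows "diag_block_mat [X, 1\<^sub>m m] * four_block_mat A B C D * diag_block_mat [Y, 1\<^sub>m m]
    = four_block_mat (X * A * Y) (X * B) (C * Y) D"
proof -
  note mult = mult_four_block_mat[of _ "dim_row X" "dim_row A" _ m _ m _ _ "dim_col A" _ m]
    mult_four_block_mat[of _ "dim_row X" "dim_col A" _ m _ m _ _ "dim_col Y" _ m]
  \<comment> \<open>The recursion of \<open>diag_block_mat\<close> ends in an empty block, so the
    identity first appears bordered by empty matrices.\<close>
  have "four_block_mat (1\<^sub>m m) (0\<^sub>m m 0) (0\<^sub>m 0 m) (0\<^sub>m 0 0) = (1\<^sub>m m :: 'a mat)"
    by (rule eq_matI) simp_all
  then have "diag_block_mat [X, 1\<^sub>m m] = four_block_mat X (0\<^sub>m (dim_row X) m) (0\<^sub>m m (dim_row A)) (1\<^sub>m m)"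
    "diag_block_mat [Y, 1\<^sub>m m] = four_block_mat Y (0\<^sub>m (dim_col A) m) (0\<^sub>m m (dim_col Y)) (1\<^sub>m m)"
    using assms by (simp_all add: Let_def)
  moreover have "four_block_mat X (0\<^sub>m (dim_row X) m) (0\<^sub>m m (dim_row A)) (1\<^sub>m m) * four_block_mat A B C D
    = four_block_mat (X * A) (X * B) C D"
    using assms by (subst mult(1)) auto
  moreover have "four_block_mat (X * A) (X * B) C D *
      four_block_mat Y (0\<^sub>m (dim_col A) m) (0\<^sub>m m (dim_col Y)) (1\<^sub>m m)
    = four_block_mat (X * A * Y) (X * B) (C * Y) D"
    using assms by (subst mult(2)) auto
  ultimately show ?thesis by simp
qed

lemma split_block_four_block_mat:
  assumes "A \<in> carrier_mat r c" "dim_row B = r" "dim_col B = dim_col D" "dim_row C = dim_row D" "dim_col C = c"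
  shows "split_block (four_block_mat A B C D) r c = (A, B, C, D)"
  using assms by (auto simp: split_block_def Let_def intro!: eq_matI)

text \<open>\<open>delete_leading\<close> is split into row and column deletion: in a product the
  first affects only the left factor and the second only the right factor, so both pass to the
  unitary matrices.\<close>

definition drop_rows :: "nat \<Rightarrow> 'a mat \<Rightarrow> 'a mat" where
  "drop_rows k M = mat (dim_row M - k) (dim_col M) (\<lambda>(i, j). M $$ (i + k, j))"

definition drop_cols :: "nat \<Rightarrow> 'a mat \<Rightarrow> 'a mat" where
  "drop_cols k M = mat (dim_row M) (dim_col M - k) (\<lambda>(i, j). M $$ (i, j + k))"

lemma dim_drop_rows [simp]:
  "dim_row (drop_rows k M) = dim_row M - k" "dim_col (drop_rows k M) = dim_col M"
  by (simp_all add: drop_rows_def)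

lemma dim_drop_cols [simp]:
  "dim_row (drop_cols k M) = dim_row M" "dim_col (drop_cols k M) = dim_col M - k"
  by (simp_all add: drop_cols_def)

lemma drop_rows_mult: "dim_col A = dim_row B \<Longrightarrow> drop_rows k (A * B) = drop_rows k A * B"
  by (rule eq_matI) (auto simp: drop_rows_def scalar_prod_def)

lemma drop_cols_mult: "drop_cols k (A * B) = A * drop_cols k B"
  by (rule eq_matI) (auto simp: drop_cols_def scalar_prod_def)

lemma drop_rows_adjoint: "drop_rows k (mat_adjoint A) = mat_adjoint (drop_cols k A)"
  by (rule eq_matI) (auto simp: drop_cols_def drop_rows_def)

lemma drop_rows_const_pmat: "drop_rows k (const_pmat A) = const_pmat (drop_rows k A)"
  by (rule eq_matI) (auto simp: const_pmat_def drop_rows_def)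

lemma drop_cols_const_pmat: "drop_cols k (const_pmat A) = const_pmat (drop_cols k A)"
  by (rule eq_matI) (auto simp: const_pmat_def drop_cols_def)

lemma drop_cols_drop_rows_one: "drop_cols k (drop_rows k (1\<^sub>m n)) = 1\<^sub>m (n - k)"
  by (rule eq_matI) (auto simp: drop_rows_def drop_cols_def)

lemma delete_leading_four_block_mat:
  assumes "k \<le> dim_row A" "k \<le> dim_col A"
    "dim_row B = dim_row A" "dim_col B = dim_col D" "dim_row C = dim_row D" "dim_col C = dim_col A"
  shows "delete_leading k (four_block_mat A B C D) =
    four_block_mat (drop_rows k (drop_cols k A)) (drop_rows k B) (drop_cols k C) D"
  using assms by (intro eq_matI) (auto simp: delete_leading_def drop_rows_def drop_cols_def)

text \<open>Written through the last \<open>r\<close> columns of the identity and their transpose,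
  the block form composes directly with \<open>U\<close> and \<open>V\<close>.\<close>

lemma four_block_zero_corner:
  fixes X :: "'a::comm_ring_1 mat"
  assumes X: "X \<in> carrier_mat r r"
  shows "four_block_mat (0\<^sub>m k k) (0\<^sub>m k r) (0\<^sub>m r k) X =
    drop_cols k (1\<^sub>m (k + r)) * X * drop_rows k (1\<^sub>m (k + r))"
proof -
  have 1: "row (drop_cols k (1\<^sub>m (k + r))) i = (if i < k then 0\<^sub>v r else unit_vec r (i - k))"
    if "i < k + r" for i
    using that by (intro eq_vecI) (auto simp: drop_cols_def)
  have 2: "col (drop_rows k (1\<^sub>m (k + r))) i = (if i < k then 0\<^sub>v r else unit_vec r (i - k))"
    if "i < k + r" for i
    using that by (intro eq_vecI) (auto simp: drop_rows_def)
  have 3: "row (drop_cols k (1\<^sub>m (k + r)) * X) i = (if i < k then 0\<^sub>v r else row X (i - k))"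
    if "i < k + r" for i
    using that X by (cases "i < k"; intro eq_vecI) (simp_all add: 1)
  have 4: "row X i \<in> carrier_vec r" for i using X row_carrier[of X i] by simp
  show ?thesis using X by (intro eq_matI) (simp_all add: 2 3 4)
qed

section \<open>The shift structure of the block Hankel matrix\<close>

text \<open>The \<open>N\<close> of the overview: one block down is \<open>m\<close> scalar rows
  down, so no block indices are needed.\<close>

definition shift_mat :: "nat \<Rightarrow> nat \<Rightarrow> complex mat" where
  "shift_mat n m = mat n n (\<lambda>(i, j). if i = j + m then 1 else 0)"

text \<open>The \<open>E\<close> of the overview: for \<open>m \<le> n\<close>, the last
  \<open>m\<close> columns of the identity.\<close>

definition last_block :: "nat \<Rightarrow> nat \<Rightarrow> complex mat" where
  "last_block n m = mat n m (\<lambda>(i, j). if i = j + (n - m) then 1 else 0)"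

lemma dim_shift_mat [simp]: "dim_row (shift_mat n m) = n" "dim_col (shift_mat n m) = n"
  by (simp_all add: shift_mat_def)

lemma dim_last_block [simp]: "dim_row (last_block n m) = n" "dim_col (last_block n m) = m"
  by (simp_all add: last_block_def)

text \<open>Entries of products with \<open>shift_mat\<close> and \<open>last_block\<close> are sums
  with at most one nonzero term. The guard \<open>m \<le> i\<close> prevents truncation of
  \<open>i - m\<close>, and \<open>i < n + m\<close> keeps it in range.\<close>

lemma sum_delta_shift:
  fixes f :: "nat \<Rightarrow> 'a::comm_semiring_1"
  shows "(\<Sum>l = 0..<n. (if i = l + m then 1 else 0) * f l) = (if m \<le> i \<and> i < n + m then f (i - m) else 0)"
proof -
  have "(\<Sum>l = 0..<n. (if i = l + m then 1 else 0) * f l)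
    = (\<Sum>l = 0..<n. if i - m = l then if m \<le> i then f l else 0 else 0)"
    by (rule sum.cong) auto
  then show ?thesis by auto
qed

lemma sum_delta_unshift:
  fixes f :: "nat \<Rightarrow> 'a::comm_semiring_1"
  shows "(\<Sum>l = 0..<n. (if l = i + m then 1 else 0) * f l) = (if i + m < n then f (i + m) else 0)"
proof -
  have "(\<Sum>l = 0..<n. (if l = i + m then 1 else 0) * f l)
    = (\<Sum>l = 0..<n. if i + m = l then f l else 0)"
    by (rule sum.cong) auto
  then show ?thesis by auto
qed

lemma index_shift_mult:
  assumes "dim_row X = n" "i < n" "j < dim_col X"
  shows "(shift_mat n m * X) $$ (i, j) = (if m \<le> i then X $$ (i - m, j) else 0)"
  using assms by (simp add: shift_mat_def scalar_prod_def sum_delta_shift)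

lemma index_mult_shift_transpose:
  assumes "dim_col X = n" "i < dim_row X" "j < n"
  shows "(X * (shift_mat n m)\<^sup>T) $$ (i, j) = (if m \<le> j then X $$ (i, j - m) else 0)"
  using assms by (simp add: shift_mat_def scalar_prod_def mult.commute[of "X $$ _"] sum_delta_shift)

lemma index_shift_transpose_mult:
  assumes "dim_row X = n" "i < n" "j < dim_col X"
  shows "((shift_mat n m)\<^sup>T * X) $$ (i, j) = (if i + m < n then X $$ (i + m, j) else 0)"
  using assms by (simp add: shift_mat_def scalar_prod_def sum_delta_unshift)

lemma index_mult_last_block:
  assumes "dim_col X = n" "i < dim_row X" "j < m" "m \<le> n"
  shows "(X * last_block n m) $$ (i, j) = X $$ (i, j + (n - m))"
proof -
  \<comment> \<open>With \<open>n = m + q\<close> the truncated difference \<open>n - m\<close>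
    becomes \<open>q\<close>.\<close>
  obtain q where "n = m + q" using assms(4) le_Suc_ex by blast
  then show ?thesis using assms by (simp add: last_block_def scalar_prod_def mult.commute[of "X $$ _"] sum_delta_unshift)
qed

lemma index_last_block_transpose_mult:
  assumes "dim_row X = n" "i < m" "j < dim_col X" "m \<le> n"
  shows "((last_block n m)\<^sup>T * X) $$ (i, j) = X $$ (i + (n - m), j)"
proof -
  obtain q where "n = m + q" using assms(4) le_Suc_ex by blast
  then show ?thesis using assms by (simp add: last_block_def scalar_prod_def sum_delta_unshift)
qed

lemma index_last_block_mult:
  assumes "dim_row X = m" "i < n" "j < dim_col X" "m \<le> n"
  shows "(last_block n m * X) $$ (i, j) = (if n - m \<le> i then X $$ (i - (n - m), j) else 0)"
proof -
  obtain q where "n = m + q" using assms(4) le_Suc_ex by blast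
  then show ?thesis using assms by (simp add: last_block_def scalar_prod_def sum_delta_shift)
qed

text \<open>The first product is the diagonal projection onto the indices with
  \<open>i + m < n\<close>, the second the one onto the remaining last \<open>m\<close>
  indices.\<close>

lemma shift_last_block_resolution:
  assumes "m \<le> n"
  shows "(shift_mat n m)\<^sup>T * shift_mat n m + last_block n m * (last_block n m)\<^sup>T = 1\<^sub>m n"
proof (rule eq_matI)
  fix i j assume "i < dim_row (1\<^sub>m n :: complex mat)" "j < dim_col (1\<^sub>m n :: complex mat)"
  then have ij: "i < n" "j < n" by simp_all
  have "((shift_mat n m)\<^sup>T * shift_mat n m) $$ (i, j) = (if i + m < n \<and> i = j then 1 else 0)"
    using ij by (subst index_shift_transpose_mult) (auto simp: shift_mat_def)
  moreover have "(last_block n m * (last_block n m)\<^sup>T) $$ (i, j) = (if n - m \<le> i \<and> i = j then 1 else 0)"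
    using ij assms by (subst index_last_block_mult) (auto simp: last_block_def)
  ultimately show "((shift_mat n m)\<^sup>T * shift_mat n m + last_block n m * (last_block n m)\<^sup>T) $$ (i, j)
      = 1\<^sub>m n $$ (i, j)"
    using ij assms by auto
qed simp_all

text \<open>For \<open>m > 0\<close> the transposed shift is strictly upper triangular, so the
  matrix is triangular with diagonal \<open>-1\<close> whatever \<open>z\<close> is.\<close>

lemma shift_resolvent:
  assumes "m > 0"
  shows "\<exists>K \<in> carrier_mat n n. (z \<cdot>\<^sub>m (shift_mat n m)\<^sup>T - 1\<^sub>m n) * K = 1\<^sub>m n"
proof -
  let ?A = "z \<cdot>\<^sub>m (shift_mat n m)\<^sup>T - 1\<^sub>m n"
  have A: "?A \<in> carrier_mat n n" by (rule carrier_matI) simp_all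
  have "upper_triangular ?A"
    by (rule upper_triangularI) (auto simp: shift_mat_def)
  then have "det ?A = prod_list (diag_mat ?A)" using A by (rule det_upper_triangular)
  moreover have "0 \<notin> set (diag_mat ?A)"
    using assms by (auto simp: diag_mat_def shift_mat_def)
  ultimately have "det ?A \<noteq> 0" by (simp add: prod_list_zero_iff)
  from det_non_zero_imp_unit[OF A this] show ?thesis
    unfolding Units_def ring_mat_simps by blast
qed

lemma index_hankel_T:
  assumes "P \<in> carrier_mat m m" "i < m * (d - 1)" "j < m * (d - 1)"
  shows "hankel_T m d P $$ (i, j) =
    coeff (P $$ (i mod m, j mod m)) (2 * d - (i div m + 1) - (j div m + 1))"
proof -
  have "m > 0" using assms by (cases m) auto
  then show ?thesis using assms by (simp add: hankel_T_def block_mat_def coeff_mat_def)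
qed

lemma dim_hankel_T [simp]:
  "dim_row (hankel_T m d P) = m * (d - 1)" "dim_col (hankel_T m d P) = m * (d - 1)"
  by (simp_all add: hankel_T_def)

text \<open>The \<open>F\<close> of the overview. Blocks are counted from 0 here, so the exponents
  run from \<open>d - 1\<close> down to 1 over the \<open>d - 1\<close> blocks.\<close>

definition power_column :: "nat \<Rightarrow> nat \<Rightarrow> complex poly mat" where
  "power_column m d =
    mat (m * (d - 1)) m (\<lambda>(i, b). if i mod m = b then monom 1 (d - 1 - i div m) else 0)"

lemma dim_power_column [simp]:
  "dim_row (power_column m d) = m * (d - 1)" "dim_col (power_column m d) = m"
  by (simp_all add: power_column_def)

lemma block_index_less:
  fixes m q i :: nat
  assumes "i < m * q"
  shows "m > 0" "i div m < q" "i mod m < m"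
proof -
  show "m > 0" using assms by (cases m) auto
  then show "i div m < q" "i mod m < m" using assms by (simp_all add: less_mult_imp_div_less mult.commute)
qed

text \<open>Counted from 0, the last of the \<open>d - 1\<close> blocks has index
  \<open>d - 2\<close>.\<close>

lemma last_block_index_iff:
  fixes m d i b :: nat
  assumes "i < m * (d - 1)" "b < m" "d > 1"
  shows "i = b + (m * (d - 1) - m) \<longleftrightarrow> i div m = d - 2 \<and> i mod m = b"
proof -
  have "m * (d - 1) - m = m * (d - 2)"
    by (metis diff_mult_distrib2 diff_diff_left mult.right_neutral one_add_one)
  moreover have "i = b + m * (d - 2) \<longleftrightarrow> i div m = d - 2 \<and> i mod m = b"
    using assms(2) by (metis add.commute div_mult_mod_eq div_mult_self1 div_less
        add.right_neutral mod_mult_self1 mod_less mult.commute less_nat_zero_code add_0)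
  ultimately show ?thesis by simp
qed

text \<open>Multiplying the next lower block by \<open>z\<close> reproduces the block itself, so all
  blocks cancel but the last, where nothing is shifted in and \<open>- z I\<close> remains.\<close>

lemma shift_power_column:
  assumes "d > 1"
  shows "(z \<cdot>\<^sub>m (shift_mat (m * (d - 1)) m)\<^sup>T - 1\<^sub>m (m * (d - 1))) * eval_mat (power_column m d) z
    = (- z) \<cdot>\<^sub>m last_block (m * (d - 1)) m"
proof (rule eq_matI)
  let ?n = "m * (d - 1)" let ?F = "eval_mat (power_column m d) z"
  fix i b assume "i < dim_row ((- z) \<cdot>\<^sub>m last_block ?n m)" "b < dim_col ((- z) \<cdot>\<^sub>m last_block ?n m)"
  then have i: "i < ?n" and b: "b < m" by simp_all
  note ib = block_index_less[OF i]
  have F: "?F $$ (i, b) = (if i mod m = b then z ^ (d - 1 - i div m) else 0)" if "i < ?n" for i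
    using that b by (auto simp: power_column_def eval_mat_def poly_monom)
  have "(((shift_mat ?n m)\<^sup>T) * ?F) $$ (i, b) = (if i + m < ?n then ?F $$ (i + m, b) else 0)"
    using i b by (subst index_shift_transpose_mult) simp_all
  moreover have "i + m < ?n \<longleftrightarrow> i div m \<noteq> d - 2"
  proof -
    have "i + m < ?n \<longleftrightarrow> (i + m) div m < d - 1"
      unfolding div_less_iff_less_mult[OF ib(1)] by (simp only: mult.commute)
    also have "(i + m) div m = i div m + 1" using ib(1) by simp
    finally show ?thesis using ib(2) by linarith
  qed
  moreover have "z * z ^ (d - 1 - (i + m) div m) = z ^ (d - 1 - i div m)" if "i div m \<noteq> d - 2"
  proof -
    have "d - 1 - i div m = Suc (d - 1 - (i + m) div m)" using that ib by simp
    then show ?thesis by simp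
  qed
  moreover have "last_block ?n m $$ (i, b) = (if i div m = d - 2 \<and> i mod m = b then 1 else 0)"
    using last_block_index_iff[OF i b assms] i b by (simp add: last_block_def)
  moreover have "d - 1 - (d - 2) = 1" using assms by simp
  moreover have "((z \<cdot>\<^sub>m (shift_mat ?n m)\<^sup>T - 1\<^sub>m ?n) * ?F) $$ (i, b)
      = z * (((shift_mat ?n m)\<^sup>T) * ?F) $$ (i, b) - ?F $$ (i, b)"
    using i b by (simp add: minus_mult_distrib_dim smult_mult_dim one_mult_dim)
  ultimately show "((z \<cdot>\<^sub>m (shift_mat ?n m)\<^sup>T - 1\<^sub>m ?n) * ?F) $$ (i, b) = ((- z) \<cdot>\<^sub>m last_block ?n m) $$ (i, b)"
    using i b ib F[OF i] F[of "i + m"] by simp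
qed simp_all

lemma block_size_le: "d > 1 \<Longrightarrow> m \<le> m * (d - 1)" for m d :: nat
  by (cases d rule: nat.exhaust) (simp_all add: Suc_le_eq)

lemma last_block_div_mod:
  fixes m d i :: nat
  assumes "i < m" "d > 1"
  shows "i + (m * (d - 1) - m) < m * (d - 1)" "(i + (m * (d - 1) - m)) div m = d - 2"
    "(i + (m * (d - 1) - m)) mod m = i"
proof -
  have "i + (n - m) < n" if "m \<le> n" for n using that assms(1) by linarith
  from this[OF block_size_le[OF assms(2)]] show *: "i + (m * (d - 1) - m) < m * (d - 1)" .
  show "(i + (m * (d - 1) - m)) div m = d - 2" "(i + (m * (d - 1) - m)) mod m = i"
    using last_block_index_iff[OF * assms] by simp_all
qed

lemma poly_eq_sum_upto:
  fixes p :: "'a::comm_semiring_1 poly"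
  assumes "\<And>k. k > d \<Longrightarrow> coeff p k = 0"
  shows "poly p z = (\<Sum>k\<le>d. coeff p k * z ^ k)"
proof -
  have "degree p \<le> d" using assms by (simp add: degree_le)
  then show ?thesis unfolding poly_altdef
    by (intro sum.mono_neutral_left) (auto simp: coeff_eq_0)
qed

lemma coeff_eq_0_of_coeff_mat:
  assumes "P \<in> carrier_mat m m" "\<forall>k>d. coeff_mat P k = 0\<^sub>m m m" "k > d" "a < m" "b < m"
  shows "coeff (P $$ (a, b)) k = 0"
proof -
  have "coeff_mat P k $$ (a, b) = 0\<^sub>m m m $$ (a, b)" using assms(2,3) by simp
  then show ?thesis using assms(1,4,5) by (simp add: coeff_mat_def)
qed

text \<open>The last block row of \<open>T\<close> is \<open>P_d, ..., P_2\<close>; against the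
  blocks \<open>z^(d-1), ..., z\<close> it yields the sum of \<open>P_k z^(k-1)\<close> for
  \<open>k\<close> from 2 to \<open>d\<close>. The outer factor \<open>z\<close> and the term
  \<open>z P_1 + P_0\<close> complete \<open>P(z)\<close>.\<close>

lemma hankel_power_column:
  assumes P: "P \<in> carrier_mat m m" and d: "d > 1"
    and deg: "\<forall>k>d. coeff_mat P k = 0\<^sub>m m m"
  shows "z \<cdot>\<^sub>m coeff_mat P 1 + coeff_mat P 0 +
    z \<cdot>\<^sub>m ((last_block (m * (d - 1)) m)\<^sup>T * (hankel_T m d P * eval_mat (power_column m d) z)) = eval_mat P z"
    (is "?L = _")
proof (rule eq_matI)
  let ?n = "m * (d - 1)" let ?T = "hankel_T m d P" let ?F = "eval_mat (power_column m d) z"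
  fix a b assume "a < dim_row (eval_mat P z)" "b < dim_col (eval_mat P z)"
  then have ab: "a < m" "b < m" using P by simp_all
  have mn: "m \<le> ?n" using block_size_le[OF d] .
  let ?p = "coeff (P $$ (a, b))"
  have T: "?T $$ (a + (?n - m), l) = coeff (P $$ (a, l mod m)) (d - l div m)" if "l < ?n" for l
  proof -
    have "2 * d - (d - 2 + 1) - (l div m + 1) = d - l div m"
      using block_index_less[OF that] d by linarith
    then show ?thesis
      using index_hankel_T[OF P last_block_div_mod(1)[OF ab(1) d] that]
      unfolding last_block_div_mod(2,3)[OF ab(1) d] by simp
  qed
  have "((last_block ?n m)\<^sup>T * (?T * ?F)) $$ (a, b) = (?T * ?F) $$ (a + (?n - m), b)"
    using ab mn by (subst index_last_block_transpose_mult) simp_all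
  also have "\<dots> = (\<Sum>l = 0..<?n. ?T $$ (a + (?n - m), l) * ?F $$ (l, b))"
    using ab last_block_div_mod(1)[OF ab(1) d] by (simp add: scalar_prod_def)
  also have "\<dots> = (\<Sum>l = 0..<?n. if l mod m = b then ?p (d - l div m) * z ^ (d - 1 - l div m) else 0)"
    by (rule sum.cong) (auto simp: T[unfolded One_nat_def] power_column_def eval_mat_def poly_monom ab)
  also have "\<dots> = (\<Sum>l | l < ?n \<and> l mod m = b. ?p (d - l div m) * z ^ (d - 1 - l div m))"
    by (simp add: sum.inter_filter[symmetric])
  also have "\<dots> = (\<Sum>k = 2..d. ?p k * z ^ (k - 1))"
  \<comment> \<open>Each block contains exactly one index \<open>l\<close> with residue
    \<open>b\<close>, so this is a sum over blocks, renumbered by the coefficient index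
    \<open>k = d - l div m\<close>.\<close>
  proof (rule sum.reindex_bij_witness[of _ "\<lambda>k. (d - k) * m + b" "\<lambda>l. d - l div m"], goal_cases)
    case (1 l)
    then show ?case using block_index_less[of l m "d - 1"] by (auto simp: mult.commute)
  next
    case (2 l)
    then show ?case using block_index_less[of l m "d - 1"] by auto
  next
    case (3 k)
    then show ?case using ab by simp
  next
    case (4 k)
    then have "(d - k) * m + b < Suc (d - k) * m" using ab by simp
    also have "\<dots> \<le> (d - 1) * m" using 4 by (intro mult_le_mono1) auto
    finally show ?case using ab by (simp add: mult.commute)
  next
    case (5 l)
    then show ?case using block_index_less[of l m "d - 1"] by auto
  qed
  finally have "?L $$ (a, b) = z * ?p 1 + ?p 0 + z * (\<Sum>k = 2..d. ?p k * z ^ (k - 1))"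
    using ab P by (simp add: coeff_mat_def)
  also have "z * (\<Sum>k = 2..d. ?p k * z ^ (k - 1)) = (\<Sum>k = 2..d. ?p k * z ^ k)"
    unfolding sum_distrib_left
  proof (rule sum.cong)
    fix k assume "k \<in> {2..d}"
    then show "z * (?p k * z ^ (k - 1)) = ?p k * z ^ k" by (cases k) simp_all
  qed simp
  also have "z * ?p 1 + ?p 0 + (\<Sum>k = 2..d. ?p k * z ^ k) = (\<Sum>k\<le>d. ?p k * z ^ k)"
  proof -
    have "{..d} = insert 0 (insert 1 {2..d})" using d by auto
    then show ?thesis by (simp add: mult.commute)
  qed
  also have "\<dots> = poly (P $$ (a, b)) z" using ab by (intro poly_eq_sum_upto[symmetric] coeff_eq_0_of_coeff_mat[OF P deg])
  finally show "?L $$ (a, b) = eval_mat P z $$ (a, b)" using ab P by (simp add: eval_mat_def)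
qed (use P in simp_all)

text \<open>Shifting rows or columns by one block raises the index of \<open>P\<close> by one, and a
  Hankel matrix depends only on the sum of the block indices. This gives
  \<open>N T = T N\<^sup>T\<close>.\<close>

lemma hankel_shift:
  assumes P: "P \<in> carrier_mat m m" and d: "d > 1"
    and deg: "\<forall>k>d. coeff_mat P k = 0\<^sub>m m m"
    and ij: "i < m * (d - 1)" "j < m * (d - 1)"
  shows "(shift_mat (m * (d - 1)) m * hankel_T m d P) $$ (i, j) =
      coeff (P $$ (i mod m, j mod m)) (2 * d + 1 - (i div m + 1) - (j div m + 1))"
    "(hankel_T m d P * (shift_mat (m * (d - 1)) m)\<^sup>T) $$ (i, j) =
      coeff (P $$ (i mod m, j mod m)) (2 * d + 1 - (i div m + 1) - (j div m + 1))"
proof -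
  let ?n = "m * (d - 1)"
  note i = block_index_less[OF ij(1)] and j = block_index_less[OF ij(2)]
  have div: "(l - m) div m = l div m - 1" "(l - m) mod m = l mod m" "l div m \<ge> 1" if le: "m \<le> l" for l
  proof -
    obtain t where "l = m + t" using le_Suc_ex[OF le] by blast
    then show "(l - m) div m = l div m - 1" "(l - m) mod m = l mod m" "l div m \<ge> 1"
      using i(1) by simp_all
  qed
  show "(shift_mat ?n m * hankel_T m d P) $$ (i, j) =
      coeff (P $$ (i mod m, j mod m)) (2 * d + 1 - (i div m + 1) - (j div m + 1))"
  proof (cases "m \<le> i")
    case True
    have "2 * d - (i div m - 1 + 1) - (j div m + 1) = 2 * d + 1 - (i div m + 1) - (j div m + 1)"
      using div(3)[OF True] by linarith
    moreover have "(shift_mat ?n m * hankel_T m d P) $$ (i, j) = hankel_T m d P $$ (i - m, j)"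
      using True ij by (subst index_shift_mult) simp_all
    moreover have "i - m < ?n" using ij(1) by linarith
    ultimately show ?thesis using index_hankel_T[OF P, of "i - m" d j] ij(2) div(1,2)[OF True] by metis
  next
    case False
    \<comment> \<open>In the first block row the index is at least \<open>d + 1\<close>, as the
      column block index is at most \<open>d - 1\<close>; the zeros brought in by the shift are
      therefore the right coefficients.\<close>
    then have "2 * d + 1 - (i div m + 1) - (j div m + 1) > d" using j by simp
    moreover have "(shift_mat ?n m * hankel_T m d P) $$ (i, j) = 0"
      using False ij by (subst index_shift_mult) simp_all
    ultimately show ?thesis using coeff_eq_0_of_coeff_mat[OF P deg _ i(3) j(3)] by simp
  qed
  show "(hankel_T m d P * (shift_mat ?n m)\<^sup>T) $$ (i, j) =
      coeff (P $$ (i mod m, j mod m)) (2 * d + 1 - (i div m + 1) - (j div m + 1))"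
  proof (cases "m \<le> j")
    case True
    have "2 * d - (i div m + 1) - (j div m - 1 + 1) = 2 * d + 1 - (i div m + 1) - (j div m + 1)"
      using div(3)[OF True] by linarith
    moreover have "(hankel_T m d P * (shift_mat ?n m)\<^sup>T) $$ (i, j) = hankel_T m d P $$ (i, j - m)"
      using True ij by (subst index_mult_shift_transpose) simp_all
    moreover have "j - m < ?n" using ij(2) by linarith
    ultimately show ?thesis using index_hankel_T[OF P, of i d "j - m"] ij(1) div(1,2)[OF True] by metis
  next
    case False
    then have "2 * d + 1 - (i div m + 1) - (j div m + 1) > d" using i by simp
    moreover have "(hankel_T m d P * (shift_mat ?n m)\<^sup>T) $$ (i, j) = 0"
      using False ij by (subst index_mult_shift_transpose) simp_all
    ultimately show ?thesis using coeff_eq_0_of_coeff_mat[OF P deg _ i(3) j(3)] by simp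
  qed
qed

section \<open>The pencil and its self-conjugate structure\<close>

definition pencil_A :: "nat \<Rightarrow> nat \<Rightarrow> complex poly mat \<Rightarrow> complex poly mat" where
  "pencil_A m d P = block_mat m (d - 1) (d - 1) (\<lambda>i j.
     lambda_times (coeff_mat P (2 * d + 1 - i - j)) - const_pmat (coeff_mat P (2 * d - i - j)))"

definition pencil_minus_B :: "nat \<Rightarrow> nat \<Rightarrow> complex poly mat \<Rightarrow> complex poly mat" where
  "pencil_minus_B m d P = block_mat m (d - 1) 1 (\<lambda>i _. lambda_times (coeff_mat P (d + 1 - i)))"

definition pencil_C :: "nat \<Rightarrow> nat \<Rightarrow> complex poly mat \<Rightarrow> complex poly mat" where
  "pencil_C m d P = block_mat m 1 (d - 1) (\<lambda>_ j. lambda_times (coeff_mat P (d + 1 - j)))"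

definition pencil_D :: "complex poly mat \<Rightarrow> complex poly mat" where
  "pencil_D P = lambda_times (coeff_mat P 1) + const_pmat (coeff_mat P 0)"

lemma pencil_Ls_blocks:
  "pencil_Ls m d P = four_block_mat (pencil_A m d P) (pencil_minus_B m d P) (pencil_C m d P) (pencil_D P)"
  by (simp add: pencil_Ls_def pencil_A_def pencil_minus_B_def pencil_C_def pencil_D_def)

lemma dim_pencil_blocks [simp]:
  "dim_row (pencil_A m d P) = m * (d - 1)" "dim_col (pencil_A m d P) = m * (d - 1)"
  "dim_row (pencil_minus_B m d P) = m * (d - 1)" "dim_col (pencil_minus_B m d P) = m"
  "dim_row (pencil_C m d P) = m" "dim_col (pencil_C m d P) = m * (d - 1)"
  "dim_row (pencil_D P) = dim_row P" "dim_col (pencil_D P) = dim_col P"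
  by (simp_all add: pencil_A_def pencil_minus_B_def pencil_C_def pencil_D_def)

text \<open>The last block column and the last block row of \<open>T\<close> list
  \<open>P_d, ..., P_2\<close>, the coefficients in the border of the pencil.\<close>

lemma index_hankel_T_last_block:
  assumes P: "P \<in> carrier_mat m m" and d: "d > 1" and i: "i < m * (d - 1)" and b: "b < m"
  shows "(hankel_T m d P * last_block (m * (d - 1)) m) $$ (i, b) = coeff (P $$ (i mod m, b)) (d - i div m)"
    "((last_block (m * (d - 1)) m)\<^sup>T * hankel_T m d P) $$ (b, i) = coeff (P $$ (b, i mod m)) (d - i div m)"
proof -
  let ?l = "b + (m * (d - 1) - m)"
  note l = last_block_div_mod[OF b d]
  have "2 * d - (i div m + 1) - (d - 2 + 1) = d - i div m" "2 * d - (d - 2 + 1) - (i div m + 1) = d - i div m"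
    using block_index_less[OF i] d by linarith+
  then have "hankel_T m d P $$ (i, ?l) = coeff (P $$ (i mod m, b)) (d - i div m)"
    "hankel_T m d P $$ (?l, i) = coeff (P $$ (b, i mod m)) (d - i div m)"
    using index_hankel_T[OF P i l(1)] index_hankel_T[OF P l(1) i] unfolding l(2,3) by simp_all
  moreover have "(hankel_T m d P * last_block (m * (d - 1)) m) $$ (i, b) = hankel_T m d P $$ (i, ?l)"
    "((last_block (m * (d - 1)) m)\<^sup>T * hankel_T m d P) $$ (b, i) = hankel_T m d P $$ (?l, i)"
    using i b block_size_le[OF d, of m]
    by (subst index_mult_last_block index_last_block_transpose_mult; simp)+
  ultimately show "(hankel_T m d P * last_block (m * (d - 1)) m) $$ (i, b) = coeff (P $$ (i mod m, b)) (d - i div m)"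
    "((last_block (m * (d - 1)) m)\<^sup>T * hankel_T m d P) $$ (b, i) = coeff (P $$ (b, i mod m)) (d - i div m)"
    by simp_all
qed

text \<open>The factored form of the pencil: the coefficient of \<open>z\<close> in the upper left
  block is the Hankel matrix shifted by one block.\<close>

lemma eval_pencil_blocks:
  assumes P: "P \<in> carrier_mat m m" and d: "d > 1"
    and deg: "\<forall>k>d. coeff_mat P k = 0\<^sub>m m m"
  shows "eval_mat (pencil_A m d P) z =
      z \<cdot>\<^sub>m (shift_mat (m * (d - 1)) m * hankel_T m d P) - hankel_T m d P"
    "eval_mat (pencil_minus_B m d P) z = z \<cdot>\<^sub>m (hankel_T m d P * last_block (m * (d - 1)) m)"
    "eval_mat (pencil_C m d P) z = z \<cdot>\<^sub>m ((last_block (m * (d - 1)) m)\<^sup>T * hankel_T m d P)"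
    "eval_mat (pencil_D P) z = z \<cdot>\<^sub>m coeff_mat P 1 + coeff_mat P 0"
proof -
  let ?n = "m * (d - 1)" and ?N = "shift_mat (m * (d - 1)) m" and ?T = "hankel_T m d P"
    and ?E = "last_block (m * (d - 1)) m"
  show "eval_mat (pencil_A m d P) z = z \<cdot>\<^sub>m (?N * ?T) - ?T"
  proof (rule eq_matI)
    fix i j assume "i < dim_row (z \<cdot>\<^sub>m (?N * ?T) - ?T)" "j < dim_col (z \<cdot>\<^sub>m (?N * ?T) - ?T)"
    then have i: "i < ?n" and j: "j < ?n" by simp_all
    have "eval_mat (pencil_A m d P) z $$ (i, j)
      = z * coeff (P $$ (i mod m, j mod m)) (2 * d + 1 - (i div m + 1) - (j div m + 1))
        - coeff (P $$ (i mod m, j mod m)) (2 * d - (i div m + 1) - (j div m + 1))"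
      using i j P block_index_less[OF i] block_index_less[OF j]
      by (simp add: pencil_A_def block_mat_def eval_mat_def const_pmat_def coeff_mat_def)
    then show "eval_mat (pencil_A m d P) z $$ (i, j) = (z \<cdot>\<^sub>m (?N * ?T) - ?T) $$ (i, j)"
      using i j hankel_shift(1)[OF P d deg i j] index_hankel_T[OF P i j]
      by (simp del: index_mult_mat(1))
  qed simp_all
  show "eval_mat (pencil_minus_B m d P) z = z \<cdot>\<^sub>m (?T * ?E)"
  proof (rule eq_matI)
    fix i j assume "i < dim_row (z \<cdot>\<^sub>m (?T * ?E))" "j < dim_col (z \<cdot>\<^sub>m (?T * ?E))"
    then have i: "i < ?n" and j: "j < m" by simp_all
    have "eval_mat (pencil_minus_B m d P) z $$ (i, j) = z * coeff (P $$ (i mod m, j)) (d - i div m)"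
      using i j P block_index_less[OF i]
      by (simp add: pencil_minus_B_def block_mat_def eval_mat_def const_pmat_def coeff_mat_def)
    then show "eval_mat (pencil_minus_B m d P) z $$ (i, j) = (z \<cdot>\<^sub>m (?T * ?E)) $$ (i, j)"
      using i j index_hankel_T_last_block(1)[OF P d i j] by (simp del: index_mult_mat(1))
  qed simp_all
  show "eval_mat (pencil_C m d P) z = z \<cdot>\<^sub>m (?E\<^sup>T * ?T)"
  proof (rule eq_matI)
    fix j i assume "j < dim_row (z \<cdot>\<^sub>m (?E\<^sup>T * ?T))" "i < dim_col (z \<cdot>\<^sub>m (?E\<^sup>T * ?T))"
    then have i: "i < ?n" and j: "j < m" by simp_all
    have "eval_mat (pencil_C m d P) z $$ (j, i) = z * coeff (P $$ (j, i mod m)) (d - i div m)"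
      using i j P block_index_less[OF i]
      by (simp add: pencil_C_def block_mat_def eval_mat_def const_pmat_def coeff_mat_def)
    then show "eval_mat (pencil_C m d P) z $$ (j, i) = (z \<cdot>\<^sub>m (?E\<^sup>T * ?T)) $$ (j, i)"
      using i j index_hankel_T_last_block(2)[OF P d i j] by (simp del: index_mult_mat(1))
  qed simp_all
  show "eval_mat (pencil_D P) z = z \<cdot>\<^sub>m coeff_mat P 1 + coeff_mat P 0"
    by (rule eq_matI) (simp_all add: pencil_D_def eval_mat_def const_pmat_def)
qed

text \<open>This is \<open>\<epsilon>\<close> in the overview; \<open>structure_twist\<close> is
  \<open>\<sigma>\<close>.\<close>

fun structure_sign :: "self_conjugate_structure \<Rightarrow> complex" where
  "structure_sign Hermitian = 1"
| "structure_sign Skew_Hermitian = - 1"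
| "structure_sign Para_Hermitian = 1"
| "structure_sign Para_Skew_Hermitian = - 1"

fun structure_twist :: "self_conjugate_structure \<Rightarrow> complex" where
  "structure_twist Hermitian = 1"
| "structure_twist Skew_Hermitian = 1"
| "structure_twist Para_Hermitian = - 1"
| "structure_twist Para_Skew_Hermitian = - 1"

lemma has_structure_iff:
  "has_structure s M \<longleftrightarrow>
    (\<forall>z. mat_adjoint (eval_mat M z) = structure_sign s \<cdot>\<^sub>m eval_mat M (structure_twist s * cnj z))"
proof -
  have "1 \<cdot>\<^sub>m X = X" "(- 1) \<cdot>\<^sub>m X = - X" for X :: "complex mat" by (auto intro: eq_matI)
  then show ?thesis by (cases s) simp_all
qed

text \<open>Taken at \<open>cnj z\<close>, both sides of the structure identity are polynomials in
  \<open>z\<close>, so their coefficients can be compared.\<close>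

lemma structure_coeff:
  assumes P: "P \<in> carrier_mat m m" and s: "has_structure s P" and ab: "a < m" "b < m"
  shows "cnj (coeff (P $$ (b, a)) k) = structure_sign s * (structure_twist s ^ k * coeff (P $$ (a, b)) k)"
proof -
  have "poly (map_poly cnj (P $$ (b, a))) z
      = poly (Polynomial.smult (structure_sign s) (pcompose (P $$ (a, b)) [:0, structure_twist s:])) z" for z
  proof -
    have "mat_adjoint (eval_mat P (cnj z)) = structure_sign s \<cdot>\<^sub>m eval_mat P (structure_twist s * z)"
      using s[unfolded has_structure_iff, rule_format, of "cnj z"] by simp
    from arg_cong[OF this, of "\<lambda>M. M $$ (a, b)"]
    have "cnj (poly (P $$ (b, a)) (cnj z)) = structure_sign s * poly (P $$ (a, b)) (structure_twist s * z)"
      using ab P by (simp add: eval_mat_def)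
    then have "poly (map_poly cnj (P $$ (b, a))) z = structure_sign s * poly (P $$ (a, b)) (structure_twist s * z)"
      by (simp only: poly_cnj complex_cnj_cnj)
    also have "structure_twist s * z = poly [:0, structure_twist s:] z" by simp
    finally show ?thesis by (simp only: poly_smult poly_pcompose)
  qed
  then have "map_poly cnj (P $$ (b, a))
      = Polynomial.smult (structure_sign s) (pcompose (P $$ (a, b)) [:0, structure_twist s:])"
    by (simp add: poly_eq_poly_eq_iff[symmetric] fun_eq_iff)
  from arg_cong[OF this, of "\<lambda>p. coeff p k"] show ?thesis
    by (simp add: coeff_map_poly coeff_pcompose_linear)
qed

text \<open>With blocks counted from 1, block \<open>i\<close> is \<open>c^(d-i) I\<close>. The
  values \<open>c = 1\<close> and \<open>c = -1\<close> give the identity and \<open>S\<close>, so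
  one matrix serves all four structures.\<close>

definition twist_mat :: "complex \<Rightarrow> nat \<Rightarrow> nat \<Rightarrow> complex mat" where
  "twist_mat c m d = mat (m * (d - 1)) (m * (d - 1))
    (\<lambda>(i, j). if i = j then c ^ (d - 1 - i div m) else 0)"

lemma dim_twist_mat [simp]:
  "dim_row (twist_mat c m d) = m * (d - 1)" "dim_col (twist_mat c m d) = m * (d - 1)"
  by (simp_all add: twist_mat_def)

lemma twist_mat_one: "twist_mat 1 m d = 1\<^sub>m (m * (d - 1))"
  by (rule eq_matI) (simp_all add: twist_mat_def)

lemma twist_mat_minus_one: "twist_mat (- 1) m d = sign_S m d"
proof (rule eq_matI)
  fix i j assume "i < dim_row (sign_S m d)" "j < dim_col (sign_S m d)"
  then have ij: "i < m * (d - 1)" "j < m * (d - 1)" by (simp_all add: sign_S_def)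
  have "i = j \<longleftrightarrow> i div m = j div m \<and> i mod m = j mod m" by (metis div_mult_mod_eq)
  then show "twist_mat (- 1) m d $$ (i, j) = sign_S m d $$ (i, j)"
    using ij block_index_less[OF ij(1)] block_index_less[OF ij(2)]
    by (auto simp: twist_mat_def sign_S_def block_mat_def)
qed (simp_all add: sign_S_def)

lemma index_twist_mult:
  assumes "dim_row X = m * (d - 1)" "i < m * (d - 1)" "j < dim_col X"
  shows "(twist_mat c m d * X) $$ (i, j) = c ^ (d - 1 - i div m) * X $$ (i, j)"
proof -
  have "(twist_mat c m d * X) $$ (i, j) = (\<Sum>l = 0..<m * (d - 1). twist_mat c m d $$ (i, l) * X $$ (l, j))"
    using assms by (simp add: scalar_prod_def)
  also have "\<dots> = (\<Sum>l = 0..<m * (d - 1). if i = l then c ^ (d - 1 - i div m) * X $$ (l, j) else 0)"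
    by (rule sum.cong) (use assms in \<open>auto simp: twist_mat_def\<close>)
  also have "\<dots> = c ^ (d - 1 - i div m) * X $$ (i, j)" using assms by simp
  finally show ?thesis .
qed

lemma index_mult_twist:
  assumes "dim_col X = m * (d - 1)" "i < dim_row X" "j < m * (d - 1)"
  shows "(X * twist_mat c m d) $$ (i, j) = c ^ (d - 1 - j div m) * X $$ (i, j)"
proof -
  have "(X * twist_mat c m d) $$ (i, j) = (\<Sum>l = 0..<m * (d - 1). X $$ (i, l) * twist_mat c m d $$ (l, j))"
    using assms by (simp add: scalar_prod_def)
  also have "\<dots> = (\<Sum>l = 0..<m * (d - 1). if j = l then c ^ (d - 1 - j div m) * X $$ (i, l) else 0)"
    by (rule sum.cong) (use assms in \<open>auto simp: twist_mat_def\<close>)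
  also have "\<dots> = c ^ (d - 1 - j div m) * X $$ (i, j)" using assms by simp
  finally show ?thesis .
qed

lemma structure_twist_square: "structure_twist s * structure_twist s = 1"
  by (cases s) simp_all

lemma twist_mat_square:
  assumes "c * c = 1"
  shows "twist_mat c m d * twist_mat c m d = 1\<^sub>m (m * (d - 1))"
proof (rule eq_matI)
  fix i j assume "i < dim_row (1\<^sub>m (m * (d - 1)) :: complex mat)" "j < dim_col (1\<^sub>m (m * (d - 1)) :: complex mat)"
  then show "(twist_mat c m d * twist_mat c m d) $$ (i, j) = 1\<^sub>m (m * (d - 1)) $$ (i, j)"
    using assms by (subst index_twist_mult) (auto simp: twist_mat_def simp flip: power_mult_distrib)
qed simp_all

lemma mat_adjoint_twist: "cnj c = c \<Longrightarrow> mat_adjoint (twist_mat c m d) = twist_mat c m d"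
  by (rule eq_matI) (auto simp: twist_mat_def)

lemma cnj_structure_twist: "cnj (structure_twist s) = structure_twist s"
  by (cases s) simp_all

text \<open>The adjoint of \<open>P_k\<close> is \<open>\<epsilon> \<sigma>^k P_k\<close>. For
  \<open>k = 2d-i-j\<close> the power splits into \<open>\<sigma>^(d-i)\<close> and
  \<open>\<sigma>^(d-j)\<close>, the blocks of \<open>S\<close> on the two sides; the coefficient of
  \<open>z\<close> has one more \<open>\<sigma>\<close>, which turns \<open>cnj z\<close> into
  \<open>w z\<close>.\<close>

lemma mat_adjoint_eval_pencil_blocks:
  assumes P: "P \<in> carrier_mat m m" and d: "d > 1"
    and deg: "\<forall>k>d. coeff_mat P k = 0\<^sub>m m m"
    and s: "has_structure s P"
  defines "S \<equiv> twist_mat (structure_twist s) m d" and "e \<equiv> structure_sign s"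
    and "w \<equiv> \<lambda>z. structure_twist s * cnj z"
  shows "mat_adjoint (eval_mat (pencil_A m d P) z) = e \<cdot>\<^sub>m (S * eval_mat (pencil_A m d P) (w z) * S)"
    "mat_adjoint (eval_mat (pencil_C m d P) z) = e \<cdot>\<^sub>m (S * eval_mat (pencil_minus_B m d P) (w z))"
    "mat_adjoint (eval_mat (pencil_minus_B m d P) z) = e \<cdot>\<^sub>m (eval_mat (pencil_C m d P) (w z) * S)"
    "mat_adjoint (eval_mat (pencil_D P) z) = e \<cdot>\<^sub>m eval_mat (pencil_D P) (w z)"
proof -
  let ?n = "m * (d - 1)" and ?N = "shift_mat (m * (d - 1)) m" and ?T = "hankel_T m d P"
    and ?E = "last_block (m * (d - 1)) m" and ?t = "structure_twist s"
  note eval = eval_pencil_blocks[OF P d deg]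
  note coeff = structure_coeff[OF P s]
  have SS: "dim_row S = ?n" "dim_col S = ?n" by (simp_all add: S_def)
  show "mat_adjoint (eval_mat (pencil_A m d P) z) = e \<cdot>\<^sub>m (S * eval_mat (pencil_A m d P) (w z) * S)"
  proof (rule eq_matI)
    fix i j assume "i < dim_row (e \<cdot>\<^sub>m (S * eval_mat (pencil_A m d P) (w z) * S))"
      "j < dim_col (e \<cdot>\<^sub>m (S * eval_mat (pencil_A m d P) (w z) * S))"
    then have i: "i < ?n" and j: "j < ?n" by (simp_all add: S_def)
    note i' = block_index_less[OF i] and j' = block_index_less[OF j]
    \<comment> \<open>\<open>K\<close> is the coefficient index in \<open>T\<close>. It is symmetric
      in the two blocks, so the adjoint meets the same index, and the exponents from the two factors
      \<open>S\<close> add up to it.\<close>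
    define K where "K = 2 * d - (i div m + 1) - (j div m + 1)"
    have K: "2 * d - (j div m + 1) - (i div m + 1) = K"
      "2 * d + 1 - (i div m + 1) - (j div m + 1) = Suc K" "2 * d + 1 - (j div m + 1) - (i div m + 1) = Suc K"
      "(d - 1 - i div m) + (d - 1 - j div m) = K"
      using i' j' by (simp_all add: K_def)
    let ?c = "coeff (P $$ (i mod m, j mod m))" and ?c' = "coeff (P $$ (j mod m, i mod m))"
    have "mat_adjoint (eval_mat (pencil_A m d P) z) $$ (i, j) = cnj (z * ?c' (Suc K) - ?c' K)"
      using i j hankel_shift(1)[OF P d deg j i] index_hankel_T[OF P j i] unfolding eval K
      by (simp del: index_mult_mat(1))
    also have "\<dots> = cnj z * (e * (?t ^ Suc K * ?c (Suc K))) - e * (?t ^ K * ?c K)"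
      using coeff[OF i'(3) j'(3)] by (simp add: e_def)
    also have "\<dots> = e * (?t ^ (d - 1 - j div m) * (?t ^ (d - 1 - i div m) * (w z * ?c (Suc K) - ?c K)))"
      unfolding w_def K(4)[symmetric] power_add by (simp add: algebra_simps power_add)
    also have "w z * ?c (Suc K) - ?c K = eval_mat (pencil_A m d P) (w z) $$ (i, j)"
      using i j hankel_shift(1)[OF P d deg i j] index_hankel_T[OF P i j] unfolding eval K K_def[symmetric]
      by (simp del: index_mult_mat(1))
    also have "?t ^ (d - 1 - i div m) * \<dots> = (S * eval_mat (pencil_A m d P) (w z)) $$ (i, j)"
      unfolding S_def using i j by (subst index_twist_mult) simp_all
    also have "?t ^ (d - 1 - j div m) * \<dots> = (S * eval_mat (pencil_A m d P) (w z) * S) $$ (i, j)"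
      unfolding S_def using i j by (subst index_mult_twist) simp_all
    finally show "mat_adjoint (eval_mat (pencil_A m d P) z) $$ (i, j)
      = (e \<cdot>\<^sub>m (S * eval_mat (pencil_A m d P) (w z) * S)) $$ (i, j)"
      using i j SS by simp
  qed (simp_all add: S_def)
  \<comment> \<open>The border coefficients carry one \<open>\<sigma>\<close> more than
    \<open>S\<close> supplies; it is absorbed into \<open>w z\<close>.\<close>
  have power: "?t ^ (d - i div m) = ?t * ?t ^ (d - 1 - i div m)" if "i < ?n" for i
  proof -
    have "d - i div m = Suc (d - 1 - i div m)" using block_index_less[OF that] by linarith
    then show ?thesis by simp
  qed
  show "mat_adjoint (eval_mat (pencil_C m d P) z) = e \<cdot>\<^sub>m (S * eval_mat (pencil_minus_B m d P) (w z))"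
  proof (rule eq_matI)
    fix i b assume "i < dim_row (e \<cdot>\<^sub>m (S * eval_mat (pencil_minus_B m d P) (w z)))"
      "b < dim_col (e \<cdot>\<^sub>m (S * eval_mat (pencil_minus_B m d P) (w z)))"
    then have i: "i < ?n" and b: "b < m" by (simp_all add: S_def)
    have "mat_adjoint (eval_mat (pencil_C m d P) z) $$ (i, b) = cnj (z * coeff (P $$ (b, i mod m)) (d - i div m))"
      using i b index_hankel_T_last_block(2)[OF P d i b] unfolding eval by (simp del: index_mult_mat(1))
    also have "\<dots> = e * (?t ^ (d - 1 - i div m) * (w z * coeff (P $$ (i mod m, b)) (d - i div m)))"
      using coeff[OF block_index_less(3)[OF i] b] unfolding power[OF i]
      by (simp add: e_def w_def power[OF i])
    also have "w z * coeff (P $$ (i mod m, b)) (d - i div m) = eval_mat (pencil_minus_B m d P) (w z) $$ (i, b)"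
      using i b index_hankel_T_last_block(1)[OF P d i b] unfolding eval by (simp del: index_mult_mat(1))
    also have "?t ^ (d - 1 - i div m) * \<dots> = (S * eval_mat (pencil_minus_B m d P) (w z)) $$ (i, b)"
      unfolding S_def using i b by (subst index_twist_mult) simp_all
    finally show "mat_adjoint (eval_mat (pencil_C m d P) z) $$ (i, b)
      = (e \<cdot>\<^sub>m (S * eval_mat (pencil_minus_B m d P) (w z))) $$ (i, b)"
      using i b SS by simp
  qed (simp_all add: S_def)
  show "mat_adjoint (eval_mat (pencil_minus_B m d P) z) = e \<cdot>\<^sub>m (eval_mat (pencil_C m d P) (w z) * S)"
  proof (rule eq_matI)
    fix b i assume "b < dim_row (e \<cdot>\<^sub>m (eval_mat (pencil_C m d P) (w z) * S))"
      "i < dim_col (e \<cdot>\<^sub>m (eval_mat (pencil_C m d P) (w z) * S))"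
    then have i: "i < ?n" and b: "b < m" by (simp_all add: S_def)
    have "mat_adjoint (eval_mat (pencil_minus_B m d P) z) $$ (b, i) = cnj (z * coeff (P $$ (i mod m, b)) (d - i div m))"
      using i b index_hankel_T_last_block(1)[OF P d i b] unfolding eval by (simp del: index_mult_mat(1))
    also have "\<dots> = e * (?t ^ (d - 1 - i div m) * (w z * coeff (P $$ (b, i mod m)) (d - i div m)))"
      using coeff[OF b block_index_less(3)[OF i]] by (simp add: e_def w_def power[OF i])
    also have "w z * coeff (P $$ (b, i mod m)) (d - i div m) = eval_mat (pencil_C m d P) (w z) $$ (b, i)"
      using i b index_hankel_T_last_block(2)[OF P d i b] unfolding eval by (simp del: index_mult_mat(1))
    also have "?t ^ (d - 1 - i div m) * \<dots> = (eval_mat (pencil_C m d P) (w z) * S) $$ (b, i)"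
      unfolding S_def using i b by (subst index_mult_twist) simp_all
    finally show "mat_adjoint (eval_mat (pencil_minus_B m d P) z) $$ (b, i)
      = (e \<cdot>\<^sub>m (eval_mat (pencil_C m d P) (w z) * S)) $$ (b, i)"
      using i b SS by simp
  qed (simp_all add: S_def)
  show "mat_adjoint (eval_mat (pencil_D P) z) = e \<cdot>\<^sub>m eval_mat (pencil_D P) (w z)"
  proof (rule eq_matI)
    fix a b assume "a < dim_row (e \<cdot>\<^sub>m eval_mat (pencil_D P) (w z))" "b < dim_col (e \<cdot>\<^sub>m eval_mat (pencil_D P) (w z))"
    then have ab: "a < m" "b < m" using P by simp_all
    show "mat_adjoint (eval_mat (pencil_D P) z) $$ (a, b) = (e \<cdot>\<^sub>m eval_mat (pencil_D P) (w z)) $$ (a, b)"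
      using ab P coeff[OF ab] unfolding eval
      by (simp add: coeff_mat_def e_def w_def algebra_simps)
  qed (use P in simp_all)
qed

section \<open>Strong minimality and the transfer function\<close>

lemma append_cols_mult_append_rows:
  fixes A B X Y :: "'a::comm_ring_1 mat"
  assumes "A \<in> carrier_mat r a" "B \<in> carrier_mat r b" "X \<in> carrier_mat a c" "Y \<in> carrier_mat b c"
  shows "append_cols A B * (X @\<^sub>r Y) = A * X + B * Y"
proof -
  have "append_cols A B * (X @\<^sub>r Y) = four_block_mat (A * X + B * Y)
      (A * 0\<^sub>m a 0 + B * 0\<^sub>m b 0) (0\<^sub>m 0 a * X + 0\<^sub>m 0 b * Y) (0\<^sub>m 0 a * 0\<^sub>m a 0 + 0\<^sub>m 0 b * 0\<^sub>m b 0)"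
    using assms unfolding append_cols_def append_rows_def
    by (subst mult_four_block_mat[of _ r a _ b _ 0 _ _ c _ 0]) auto
  then show ?thesis using assms by (intro eq_matI) simp_all
qed

lemma append_cols_carrier:
  "A \<in> carrier_mat r a \<Longrightarrow> B \<in> carrier_mat r b \<Longrightarrow> append_cols A B \<in> carrier_mat r (a + b)"
  by (auto simp: append_cols_def)

text \<open>\<open>X\<close> stacked on \<open>Y\<close> is a right inverse of the
  concatenation.\<close>

lemma rank_append_cols:
  fixes A B X Y :: "'a::field mat"
  assumes "A \<in> carrier_mat r a" "B \<in> carrier_mat r b" "X \<in> carrier_mat a r" "Y \<in> carrier_mat b r"
    and "A * X + B * Y = 1\<^sub>m r"
  shows "vec_space.rank r (append_cols A B) = r"
  by (rule rank_eq_dim_rowI[OF append_cols_carrier[OF assms(1,2)] carrier_append_rows[OF assms(3,4)]])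
    (simp add: append_cols_mult_append_rows[OF assms(1-4)] assms(5))

lemma rank_append_rows:
  fixes A C X Y :: "'a::field mat"
  assumes "A \<in> carrier_mat a r" "C \<in> carrier_mat c r" "X \<in> carrier_mat r a" "Y \<in> carrier_mat r c"
    and "X * A + Y * C = 1\<^sub>m r"
  shows "vec_space.rank (a + c) (A @\<^sub>r C) = r"
  by (rule rank_eq_dim_colI[OF carrier_append_rows[OF assms(1,2)] append_cols_carrier[OF assms(3,4)]])
    (simp add: append_cols_mult_append_rows[OF assms(3,4,1,2)] assms(5))

lemma eval_append_cols:
  "dim_row A = dim_row B \<Longrightarrow> eval_mat (append_cols A B) z = append_cols (eval_mat A z) (eval_mat B z)"
  unfolding append_cols_def by (subst eval_four_block_mat) (auto simp: eval_mat_def intro!: cong_four_block_mat)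

lemma eval_append_rows:
  "dim_col A = dim_col C \<Longrightarrow> eval_mat (A @\<^sub>r C) z = eval_mat A z @\<^sub>r eval_mat C z"
  unfolding append_rows_def by (subst eval_four_block_mat) (auto simp: eval_mat_def intro!: cong_four_block_mat)

lemma coeff_append_cols:
  "dim_row A = dim_row B \<Longrightarrow> coeff_mat (append_cols A B) k = append_cols (coeff_mat A k) (coeff_mat B k)"
  unfolding append_cols_def by (subst coeff_four_block_mat) (auto simp: coeff_mat_def intro!: cong_four_block_mat)

lemma coeff_append_rows:
  "dim_col A = dim_col C \<Longrightarrow> coeff_mat (A @\<^sub>r C) k = coeff_mat A k @\<^sub>r coeff_mat C k"
  unfolding append_rows_def by (subst coeff_four_block_mat) (auto simp: coeff_mat_def intro!: cong_four_block_mat)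

lemma append_cols_zero: "append_cols (0\<^sub>m r a) (0\<^sub>m r b) = 0\<^sub>m r (a + b)"
  by (rule eq_matI) (simp_all add: append_cols_def)

lemma append_rows_zero: "0\<^sub>m a r @\<^sub>r 0\<^sub>m c r = 0\<^sub>m (a + c) r"
  by (rule eq_matI) (simp_all add: append_rows_def)

text \<open>Excludes a vanishing leading coefficient once its rank is known to be positive.\<close>

lemma zero_mat_rank:
  assumes "vec_space.rank n (0\<^sub>m n nc :: 'a::field mat) = r"
  shows "r = 0"
proof -
  interpret vec_space "TYPE('a)" n .
  show ?thesis using assms rank_0I[of nc] by simp
qed

lemma mat_adjoint_four_block_mat:
  assumes "dim_row B = dim_row A" "dim_col B = dim_col D" "dim_row C = dim_row D" "dim_col C = dim_col A"
  shows "mat_adjoint (four_block_mat A B C D) =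
    four_block_mat (mat_adjoint A) (mat_adjoint C) (mat_adjoint B) (mat_adjoint D)"
  using assms by (intro eq_matI) simp_all

lemma const_pmat_diag: "const_pmat (diag_block_mat [X, 1\<^sub>m m]) = diag_block_mat [const_pmat X, 1\<^sub>m m]"
  for X :: "'a::comm_ring_1 mat"
  by (rule eq_matI) (auto simp: Let_def const_pmat_def)

text \<open>The truncated identity starts with \<open>k\<close> zero rows; this is the source of the
  zero rows of the transformed pencil.\<close>

lemma index_drop_cols_one_mult:
  assumes "i < k" "i < n" "dim_row X = n - k" "j < dim_col X"
  shows "(drop_cols k (1\<^sub>m n) * X) $$ (i, j) = (0::'a::comm_ring_1)"
proof -
  have "row (drop_cols k (1\<^sub>m n)) i = (0\<^sub>v (n - k) :: 'a vec)"
    using assms by (intro eq_vecI) (auto simp: drop_cols_def)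
  moreover have "col X j \<in> carrier_vec (n - k)" using assms by (simp add: carrier_vecI)
  ultimately show ?thesis using assms by simp
qed

lemma index_mult_drop_rows_one:
  assumes "j < k" "j < n" "dim_col X = n - k" "i < dim_row X"
  shows "(X * drop_rows k (1\<^sub>m n)) $$ (i, j) = (0::'a::comm_ring_1)"
proof -
  have "col (drop_rows k (1\<^sub>m n)) j = (0\<^sub>v (n - k) :: 'a vec)"
    using assms by (intro eq_vecI) (auto simp: drop_rows_def)
  moreover have "row X i \<in> carrier_vec (n - k)" using assms row_carrier[of X i] by simp
  ultimately show ?thesis using assms by simp
qed

section \<open>Determinants and inverses under evaluation and over rational functions\<close>

lemma poly_eval_comm_ring_hom: "comm_ring_hom (\<lambda>p. poly p (z::'a::comm_ring_1))"
  by unfold_locales simp_all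

lemma det_eval_mat: "det (eval_mat A z) = poly (det A) (z::'a::comm_ring_1)"
  unfolding eval_mat_def by (rule comm_ring_hom.hom_det[OF poly_eval_comm_ring_hom])

lemma rational_det: "det (rational_mat A) = Fract (det (A :: 'a::field poly mat)) 1"
proof -
  interpret comm_ring_hom "\<lambda>p :: 'a poly. Fract p 1"
    by unfold_locales (simp_all add: Zero_fract_def One_fract_def)
  show ?thesis unfolding rational_mat_def by (rule hom_det)
qed

lemma mat_inverse_of_det:
  fixes A :: "'a::field mat"
  assumes A: "A \<in> carrier_mat n n" and det: "det A \<noteq> 0"
  shows "the (mat_inverse A) * A = 1\<^sub>m n" "the (mat_inverse A) \<in> carrier_mat n n"
proof -
  have "mat_inverse A \<noteq> None"
    using mat_inverse(1)[OF A, of undefined] det_non_zero_imp_unit[OF A det, of undefined] by blast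
  then obtain B where "mat_inverse A = Some B" by blast
  then show "the (mat_inverse A) * A = 1\<^sub>m n" "the (mat_inverse A) \<in> carrier_mat n n"
    using mat_inverse(2)[OF A] by auto
qed

text \<open>A polynomial solution \<open>X\<close> of \<open>A X = - B\<close> replaces the
  computation of the inverse. Here \<open>B\<close> names the upper right block, so
  \<open>- B\<close> is the \<open>B(\<lambda>)\<close> of the system matrix.\<close>

lemma transfer_function_eqI:
  assumes A: "A \<in> carrier_mat r r" and B: "B \<in> carrier_mat r n" and C: "C \<in> carrier_mat m r"
    and D: "D \<in> carrier_mat m n" and X: "X \<in> carrier_mat r n"
    and det: "det A \<noteq> 0" and AX: "A * X = - B" and P: "D + C * X = P"
  shows "transfer_function r (four_block_mat A B C D) = rational_mat P"
proof -
  let ?I = "the (mat_inverse (rational_mat A))"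
  have rA: "rational_mat A \<in> carrier_mat r r" using A by (intro carrier_matI) simp_all
  have "det (rational_mat A) \<noteq> 0" using det by (simp add: rational_det Zero_fract_def eq_fract)
  note I = mat_inverse_of_det[OF rA this]
  have "?I * rational_mat (- B) = ?I * (rational_mat A * rational_mat X)"
    using A X by (simp add: rational_mat_mult flip: AX)
  also have "\<dots> = (?I * rational_mat A) * rational_mat X" using A X I(2) by (simp add: mult_mat_assoc)
  also have "\<dots> = rational_mat X" unfolding I(1) using X by (simp add: one_mult_dim)
  finally have IB: "?I * rational_mat (- B) = rational_mat X" .
  have "rational_mat C * ?I * rational_mat (- B) = rational_mat (C * X)"
    using A B C X I(2) by (simp add: mult_mat_assoc IB rational_mat_mult)
  then have "rational_mat D + rational_mat C * ?I * rational_mat (- B) = rational_mat P"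
    using C D X by (simp add: rational_mat_add flip: P)
  moreover have "split_block (four_block_mat A B C D) r r = (A, B, C, D)"
    using A B C D by (intro split_block_four_block_mat) auto
  ultimately show ?thesis by (simp add: transfer_function_def)
qed

context compressed_pencil
begin

text \<open>At finite points the square block \<open>A\<close> is already invertible, which settles
  both ranks; at infinity the one-sided inverses of the leading coefficients do. The assumption
  \<open>r > 0\<close> yields degree exactly 1.\<close>

lemma strongly_minimal_four_block:
  assumes AB: "A \<in> carrier_mat r r" "B \<in> carrier_mat r m" "C \<in> carrier_mat m r" "D \<in> carrier_mat m m"
    and evA: "\<And>z. eval_mat A z = Uh * (z \<cdot>\<^sub>m (N * T) - T) * V"
    and evB: "\<And>z. eval_mat B z = z \<cdot>\<^sub>m (Uh * (T * E))"
    and evC: "\<And>z. eval_mat C z = z \<cdot>\<^sub>m (Et * T * V)"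
    and evD: "\<And>z. eval_mat D z = z \<cdot>\<^sub>m D1 + D0"
    and D10: "D1 \<in> carrier_mat m m" "D0 \<in> carrier_mat m m"
    and r: "r > 0"
  shows "strongly_minimal r m m (four_block_mat A B C D)" "det A \<noteq> 0"
proof -
  have split: "split_block (four_block_mat A B C D) r r = (A, B, C, D)"
    using AB by (intro split_block_four_block_mat) auto
  have dimA: "dim_row A = r" "dim_col A = r" "dim_row B = r" "dim_col B = m" "dim_row C = m" "dim_col C = r"
    "dim_row D = m" "dim_col D = m"
    using AB by auto
  note coeffA = coeff_mat_of_eval_linear[of "Uh * (N * T) * V" A "- (Uh * T * V)"]
    and coeffB = coeff_mat_of_eval_linear[of "Uh * (T * E)" B "0\<^sub>m r m"]
    and coeffC = coeff_mat_of_eval_linear[of "Et * T * V" C "0\<^sub>m m r"]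
    and coeffD = coeff_mat_of_eval_linear[of D1 D D0]
  have linA: "eval_mat A z = z \<cdot>\<^sub>m (Uh * (N * T) * V) + - (Uh * T * V)" for z
    unfolding evA by (simp add: mat_dim_simps) (rule eq_matI; simp del: index_mult_mat(1))
  have linB: "eval_mat B z = z \<cdot>\<^sub>m (Uh * (T * E)) + 0\<^sub>m r m" for z
    unfolding evB by (rule eq_matI) simp_all
  have linC: "eval_mat C z = z \<cdot>\<^sub>m (Et * T * V) + 0\<^sub>m m r" for z
    unfolding evC by (rule eq_matI) simp_all
  have carr: "Uh * (N * T) * V \<in> carrier_mat (dim_row A) (dim_col A)"
      "- (Uh * T * V) \<in> carrier_mat (dim_row A) (dim_col A)"
      "Uh * (T * E) \<in> carrier_mat (dim_row B) (dim_col B)" "0\<^sub>m r m \<in> carrier_mat (dim_row B) (dim_col B)"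
      "Et * T * V \<in> carrier_mat (dim_row C) (dim_col C)" "0\<^sub>m m r \<in> carrier_mat (dim_row C) (dim_col C)"
    by (rule carrier_matI; simp add: dimA)+
  have A1: "coeff_mat A 1 = Uh * (N * T) * V" and A2: "\<And>k. k > 1 \<Longrightarrow> coeff_mat A k = 0\<^sub>m r r"
    using coeffA[OF carr(1) carr(2) linA] by (simp_all add: dimA)
  have B1: "coeff_mat B 1 = Uh * (T * E)" and B2: "\<And>k. k > 1 \<Longrightarrow> coeff_mat B k = 0\<^sub>m r m"
    using coeffB[OF carr(3) carr(4) linB] by (simp_all add: dimA)
  have C1: "coeff_mat C 1 = Et * T * V" and C2: "\<And>k. k > 1 \<Longrightarrow> coeff_mat C k = 0\<^sub>m m r"
    using coeffC[OF carr(5) carr(6) linC] by (simp_all add: dimA)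
  have D2: "\<And>k. k > 1 \<Longrightarrow> coeff_mat D k = 0\<^sub>m m m"
    using coeffD[OF _ _ evD] D10 by (simp_all add: dimA)
  show detA: "det A \<noteq> 0"
  proof
    assume "det A = 0"
    \<comment> \<open>One point suffices to contradict a vanishing determinant.\<close>
    then have "det (eval_mat A 0) = 0" by (simp add: det_eval_mat)
    moreover obtain X where X: "X \<in> carrier_mat r r" "eval_mat A 0 * X = 1\<^sub>m r"
      unfolding evA by (rule compressed_invertible)
    moreover have "det (eval_mat A 0 * X) = det (eval_mat A 0) * det X"
      using X(1) AB by (intro det_mult) (auto intro: carrier_matI)
    ultimately show False by simp
  qed
  have "coeff_mat (four_block_mat A B C D) k = 0\<^sub>m (r + m) (r + m)" if "k > 1" for k
    using that by (subst coeff_four_block_mat) (simp_all add: dimA A2 B2 C2 D2)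
  then have system: "linear_system_matrix r m m (four_block_mat A B C D)"
    using AB detA unfolding linear_system_matrix_def split by (auto simp: regular_pmat_def)
  have rank_AB: "vec_space.rank r (eval_mat (append_cols A B) z) = r"
    and rank_AC: "vec_space.rank (r + m) (eval_mat (A @\<^sub>r C) z) = r" for z
  proof -
    obtain X where X: "X \<in> carrier_mat r r" "eval_mat A z * X = 1\<^sub>m r" "X * eval_mat A z = 1\<^sub>m r"
      unfolding evA by (rule compressed_invertible)
    have ev: "eval_mat A z \<in> carrier_mat r r" "eval_mat B z \<in> carrier_mat r m" "eval_mat C z \<in> carrier_mat m r"
      using AB by (auto intro: carrier_matI)
    \<comment> \<open>Since \<open>A\<close> is invertible at \<open>z\<close>, the other block can
      be paired with a zero matrix.\<close>
    have zero: "eval_mat B z * 0\<^sub>m m r = 0\<^sub>m r r" "0\<^sub>m r m * eval_mat C z = 0\<^sub>m r r"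
      by (rule right_mult_zero_mat[OF ev(2)], rule left_mult_zero_mat[OF ev(3)])
    have "vec_space.rank r (append_cols (eval_mat A z) (eval_mat B z)) = r"
      using ev X by (intro rank_append_cols[of _ r r _ m X "0\<^sub>m m r"]) (auto simp: zero)
    then show "vec_space.rank r (eval_mat (append_cols A B) z) = r"
      by (simp add: eval_append_cols dimA)
    have "vec_space.rank (r + m) (eval_mat A z @\<^sub>r eval_mat C z) = r"
      using ev X by (intro rank_append_rows[of _ r r _ m X "0\<^sub>m r m"]) (auto simp: zero)
    then show "vec_space.rank (r + m) (eval_mat (A @\<^sub>r C) z) = r"
      by (simp add: eval_append_rows dimA)
  qed
  have lead_AB: "vec_space.rank r (coeff_mat (append_cols A B) 1) = r"
    unfolding coeff_append_cols[OF trans[OF dimA(1) dimA(3)[symmetric]]] A1 B1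
    by (rule rank_append_cols[OF _ _ _ _ leading_right_inverse]; rule carrier_matI; simp)
  have lead_AC: "vec_space.rank (r + m) (coeff_mat (A @\<^sub>r C) 1) = r"
    unfolding coeff_append_rows[OF trans[OF dimA(2) dimA(6)[symmetric]]] A1 C1
    by (rule rank_append_rows[OF _ _ _ _ leading_left_inverse]; rule carrier_matI; simp)
  \<comment> \<open>A zero leading coefficient would have rank 0 instead of
    \<open>r > 0\<close>.\<close>
  have "coeff_mat (append_cols A B) 1 \<noteq> 0\<^sub>m r (r + m)" "coeff_mat (A @\<^sub>r C) 1 \<noteq> 0\<^sub>m (r + m) r"
    using lead_AB lead_AC zero_mat_rank r by (metis less_irrefl)+
  moreover have "coeff_mat (append_cols A B) k = 0\<^sub>m r (r + m)" "coeff_mat (A @\<^sub>r C) k = 0\<^sub>m (r + m) r"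
    if "k > 1" for k
    using that by (simp_all add: coeff_append_cols coeff_append_rows dimA A2 B2 C2 append_cols_zero append_rows_zero)
  moreover have "dim_row (append_cols A B) = r" "dim_col (append_cols A B) = r + m"
    "dim_row (A @\<^sub>r C) = r + m" "dim_col (A @\<^sub>r C) = r"
    by (simp_all add: append_cols_def append_rows_def dimA)
  ultimately have "has_degree (append_cols A B) 1" "has_degree (A @\<^sub>r C) 1"
    by (simp_all add: has_degree_def)
  then show "strongly_minimal r m m (four_block_mat A B C D)"
    using system rank_AB rank_AC lead_AB lead_AC unfolding strongly_minimal_def split by simp
qed

end

theorem theorem4p2:
  fixes P :: "complex poly mat" and U V T_hat :: "complex mat"
    and m d r :: nat and s :: self_conjugate_structure
  assumes "P \<in> carrier_mat m m"
    and "d > 1"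
    and "has_degree P d"
    and "has_structure s P"
    and "r = vec_space.rank (m * (d - 1)) (hankel_T m d P)"
    and "unitary_mat (m * (d - 1)) U"
    and "unitary_mat (m * (d - 1)) V"
    and "T_hat \<in> carrier_mat r r"
    and "invertible_mat T_hat"
    and "mat_adjoint U * hankel_T m d P * V =
      four_block_mat (0\<^sub>m (m * (d - 1) - r) (m * (d - 1) - r)) (0\<^sub>m (m * (d - 1) - r) r)
        (0\<^sub>m r (m * (d - 1) - r)) T_hat"
    and "s = Hermitian \<or> s = Skew_Hermitian \<Longrightarrow> U = V"
    and "s = Para_Hermitian \<or> s = Para_Skew_Hermitian \<Longrightarrow> U = sign_S m d * V"
  shows "let k = m * (d - 1) - r;
             M = transformed_pencil m U V (pencil_Ls m d P);
             L_hat = delete_leading k M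
         in (\<forall>i < m * d. \<forall>j < m * d. i < k \<or> j < k \<longrightarrow> M $$ (i, j) = 0) \<and>
            strongly_minimal_linearization r m m L_hat (rational_mat P) \<and>
            has_structure s L_hat"
proof -

  \<comment> \<open>Factorization of \<open>T\<close> through the last \<open>r\<close> columns of
    \<open>U\<close> and \<open>V\<close>\<close>
  define n where "n = m * (d - 1)"
  define k where "k = n - r"
  define T where "T = hankel_T m d P"
  define N where "N = shift_mat n m"
  define E where "E = last_block n m"
  \<comment> \<open>\<open>J\<close> and its transpose \<open>Jh\<close> omit the first
    \<open>k\<close> coordinates, so that \<open>U2 = U * J\<close> and
    \<open>V2 = V * J\<close>.\<close>
  define J where "J = drop_cols k (1\<^sub>m n :: complex mat)"
  define Jh where "Jh = drop_rows k (1\<^sub>m n :: complex mat)"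
  define U2 where "U2 = drop_cols k U"
  define V2 where "V2 = drop_cols k V"
  note P = assms(1) and d = assms(2)
  have deg: "\<forall>k>d. coeff_mat P k = 0\<^sub>m m m" and Pd: "coeff_mat P d \<noteq> 0\<^sub>m m m"
    using assms(3) P by (auto simp: has_degree_def)
  note eval = eval_pencil_blocks[OF P d deg, folded n_def, folded N_def E_def T_def]
  have UV: "U \<in> carrier_mat n n" "mat_adjoint U * U = 1\<^sub>m n" "U * mat_adjoint U = 1\<^sub>m n"
    "V \<in> carrier_mat n n" "mat_adjoint V * V = 1\<^sub>m n" "V * mat_adjoint V = 1\<^sub>m n"
    using assms(6,7) by (simp_all add: unitary_mat_def n_def)
  have [simp]: "dim_row U = n" "dim_col U = n" "dim_row V = n" "dim_col V = n" "dim_row P = m" "dim_col P = m"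
    "dim_row T = n" "dim_col T = n" "dim_row N = n" "dim_col N = n" "dim_row E = n" "dim_col E = m"
    "dim_row T_hat = r" "dim_col T_hat = r"
    using UV P assms(8) by (auto simp: T_def N_def E_def n_def)
  have UTV: "mat_adjoint U * T * V = four_block_mat (0\<^sub>m k k) (0\<^sub>m k r) (0\<^sub>m r k) T_hat"
    using assms(10) by (simp add: T_def k_def n_def)
  \<comment> \<open>The difference \<open>k = n - r\<close> could be truncated; comparing row counts
    in \<open>UTV\<close> rules this out.\<close>
  have kr: "k + r = n" using arg_cong[OF UTV, of dim_row] by simp
  have nk: "n - k = r" using kr by simp
  have [simp]: "dim_row J = n" "dim_col J = r" "dim_row Jh = r" "dim_col Jh = n"
    "dim_row U2 = n" "dim_col U2 = r" "dim_row V2 = n" "dim_col V2 = r"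
    by (simp_all add: J_def Jh_def U2_def V2_def nk)
  let ?Uh = "mat_adjoint U2" and ?Vh = "mat_adjoint V2"
  have UTV': "mat_adjoint U * T * V = J * T_hat * Jh"
    unfolding UTV four_block_zero_corner[OF assms(8)] kr J_def Jh_def ..
  have UJ: "U * J = U2" and VJ: "V * J = V2"
    by (simp_all add: J_def U2_def V2_def mult_one_dim flip: drop_cols_mult)
  have JU: "Jh * mat_adjoint U = ?Uh" and JV: "Jh * mat_adjoint V = ?Vh"
    by (simp_all add: Jh_def U2_def V2_def one_mult_dim flip: drop_rows_adjoint drop_rows_mult)
  \<comment> \<open>Unitarity cancels \<open>V\<close> here and \<open>U\<close> in
    \<open>TV\<close>, isolating the outer factors \<open>J\<close> and \<open>Jh\<close> that later
    force zero rows and columns.\<close>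
  have UT: "mat_adjoint U * T = J * (T_hat * ?Vh)"
  proof -
    have "mat_adjoint U * T = (mat_adjoint U * T * V) * mat_adjoint V"
      by (simp add: mult_mat_assoc UV mult_one_dim)
    then show ?thesis unfolding UTV' by (simp add: mult_mat_assoc JV)
  qed
  have TV: "T * V = U2 * T_hat * Jh"
  proof -
    have "T * V = U * (mat_adjoint U * T * V)"
      by (simp add: UV one_mult_dim flip: mult_mat_assoc)
    then show ?thesis unfolding UTV' by (simp add: UJ flip: mult_mat_assoc)
  qed
  have T_eq: "T = U2 * (T_hat * ?Vh)"
  proof -
    have "T = U * (mat_adjoint U * T)" by (simp add: UV one_mult_dim flip: mult_mat_assoc)
    then show ?thesis unfolding UT by (simp add: UJ flip: mult_mat_assoc)
  qed
  have iso: "?Uh * U2 = 1\<^sub>m r" "?Vh * V2 = 1\<^sub>m r"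
    using UV drop_cols_drop_rows_one[of k n]
    by (simp_all add: U2_def V2_def nk flip: drop_rows_adjoint drop_rows_mult drop_cols_mult)
  obtain T_inv where T_inv: "T_inv \<in> carrier_mat r r" "T_hat * T_inv = 1\<^sub>m r" "T_inv * T_hat = 1\<^sub>m r"
  proof -
    obtain B where B: "inverts_mat T_hat B" "inverts_mat B T_hat"
      using assms(9) by (auto simp: invertible_mat_def)
    then have 1: "T_hat * B = 1\<^sub>m r" "B * T_hat = 1\<^sub>m (dim_row B)" by (simp_all add: inverts_mat_def)
    from arg_cong[OF 1(1), of dim_col] arg_cong[OF 1(2), of dim_col] have "dim_col B = r" "dim_row B = r"
      by simp_all
    then show ?thesis using 1 by (intro that[of B]) auto
  qed

  \<comment> \<open>Positivity of the rank and the shift relations\<close>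
  have nonzero: "T \<noteq> 0\<^sub>m n n"
  proof
    assume T0: "T = 0\<^sub>m n n"
    have "coeff_mat P d = 0\<^sub>m m m"
    proof (rule eq_matI)
      fix a b assume "a < dim_row (0\<^sub>m m m :: complex mat)" "b < dim_col (0\<^sub>m m m :: complex mat)"
      then have ab: "a < m" "b < m" by simp_all
      have b: "b < m * (d - 1)" using ab(2) block_size_le[OF d, of m] by linarith
      \<comment> \<open>The last block row of \<open>T\<close> begins with the leading coefficient
        of \<open>P\<close>.\<close>
      have "0 = (E\<^sup>T * T) $$ (a, b)" using ab b unfolding T0 by (simp add: n_def)
      also have "\<dots> = coeff (P $$ (a, b)) d"
        using index_hankel_T_last_block(2)[OF P d b ab(1)] ab(2) by (simp add: E_def T_def n_def)
      finally show "coeff_mat P d $$ (a, b) = 0\<^sub>m m m $$ (a, b)" using ab by (simp add: coeff_mat_def)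
    qed simp_all
    then show False using Pd by simp
  qed
  have r: "r > 0"
  proof (rule ccontr)
    assume "\<not> r > 0"
    \<comment> \<open>For \<open>r = 0\<close> the inner dimension in \<open>T_eq\<close> is 0 and
      all entries are empty sums.\<close>
    then have "T = 0\<^sub>m n n" by (subst T_eq) (intro eq_matI; simp add: scalar_prod_def)
    then show False using nonzero by simp
  qed
  \<comment> \<open>\<open>m = 0\<close> would give \<open>n = 0\<close>, hence
    \<open>r = 0\<close>.\<close>
  have mpos: "m > 0" using r kr by (cases m) (auto simp: n_def)
  have mn: "m \<le> n" unfolding n_def by (rule block_size_le[OF d])
  have shift: "N * T = T * N\<^sup>T"
  proof (rule eq_matI)
    fix i j assume "i < dim_row (T * N\<^sup>T)" "j < dim_col (T * N\<^sup>T)"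
    then have "i < m * (d - 1)" "j < m * (d - 1)" by (simp_all add: n_def)
    from hankel_shift[OF P d deg this] show "(N * T) $$ (i, j) = (T * N\<^sup>T) $$ (i, j)"
      unfolding N_def T_def n_def by (rule trans[OF _ sym])
  qed simp_all
  interpret compressed_pencil n m r N "N\<^sup>T" T E "E\<^sup>T" U2 ?Uh V2 ?Vh T_hat T_inv
  proof
    show "N\<^sup>T * N + E * E\<^sup>T = 1\<^sub>m n" unfolding N_def E_def by (rule shift_last_block_resolution[OF mn])
    show "\<exists>K\<in>carrier_mat n n. (z \<cdot>\<^sub>m N\<^sup>T - 1\<^sub>m n) * K = 1\<^sub>m n" for z
      unfolding N_def by (rule shift_resolvent[OF mpos])
  qed (use T_inv assms(8) iso T_eq shift in \<open>auto intro!: carrier_matI\<close>)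

  \<comment> \<open>The transformed pencil and its truncation\<close>
  define A where "A = pencil_A m d P"
  define B where "B = pencil_minus_B m d P"
  define C where "C = pencil_C m d P"
  define D where "D = pencil_D P"
  note eval = eval[folded A_def B_def C_def D_def]
  have [simp]: "dim_row A = n" "dim_col A = n" "dim_row B = n" "dim_col B = m" "dim_row C = m" "dim_col C = n"
    "dim_row D = m" "dim_col D = m"
    by (simp_all add: A_def B_def C_def D_def n_def)
  define M where "M = transformed_pencil m U V (pencil_Ls m d P)"
  let ?cU = "const_pmat (mat_adjoint U)" and ?cV = "const_pmat V"
  have M: "M = four_block_mat (?cU * A * ?cV) (?cU * B) (C * ?cV) D"
    unfolding M_def transformed_pencil_def pencil_Ls_blocks const_pmat_diag A_def[symmetric]
      B_def[symmetric] C_def[symmetric] D_def[symmetric]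
    by (rule diag_conjugation_four_block) simp_all
  let ?A = "const_pmat ?Uh * A * const_pmat V2" and ?B = "const_pmat ?Uh * B" and ?C = "C * const_pmat V2"
  have L_hat: "delete_leading k M = four_block_mat ?A ?B ?C D"
  proof -
    have kn: "k \<le> n" using kr by simp
    \<comment> \<open>Deletion acts on the outer factors only, leaving the adjoint of
      \<open>U2\<close> and \<open>V2\<close>.\<close>
    have "drop_rows k ?cU = const_pmat ?Uh" "drop_cols k ?cV = const_pmat V2"
      by (simp_all add: drop_rows_const_pmat drop_cols_const_pmat drop_rows_adjoint U2_def V2_def)
    then show ?thesis unfolding M using kn
      by (subst delete_leading_four_block_mat) (simp_all add: drop_cols_mult drop_rows_mult)
  qed
  have eval_hat: "eval_mat ?A z = ?Uh * (z \<cdot>\<^sub>m (N * T) - T) * V2"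
    "eval_mat ?B z = z \<cdot>\<^sub>m (?Uh * (T * E))" "eval_mat ?C z = z \<cdot>\<^sub>m (E\<^sup>T * T * V2)" for z
    by (simp_all add: eval_mat_mult eval mult_smult_dim smult_mult_dim)

  \<comment> \<open>Vanishing of the first \<open>k\<close> rows and columns\<close>
  have zeros: "M $$ (i, j) = 0" if ij: "i < m * d" "j < m * d" "i < k \<or> j < k" for i j
  proof -
    have "m * d = n + m" using d by (cases d) (auto simp: n_def)
    with ij have ij': "i < n + m" "j < n + m" by simp_all
    have kn: "k \<le> n" using kr by simp
    let ?H = "\<lambda>z. z \<cdot>\<^sub>m (N * T) - T"
    \<comment> \<open>The shift relation lets \<open>T\<close> be pulled out on either side: on the
      left it meets the adjoint of \<open>U\<close> and exposes \<open>J\<close>, on the right it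
      meets \<open>V\<close> and exposes \<open>Jh\<close>.\<close>
    have HT: "?H z = T * (z \<cdot>\<^sub>m N\<^sup>T - 1\<^sub>m n)" "?H z = (z \<cdot>\<^sub>m N - 1\<^sub>m n) * T" for z
      by (simp_all add: mat_dim_simps shift)
    have ev: "eval_mat M z = four_block_mat (mat_adjoint U * ?H z * V) (z \<cdot>\<^sub>m (mat_adjoint U * (T * E)))
        (z \<cdot>\<^sub>m (E\<^sup>T * (T * V))) (z \<cdot>\<^sub>m coeff_mat P 1 + coeff_mat P 0)" for z
      unfolding M by (subst eval_four_block_mat)
        (simp_all add: eval_mat_mult eval mult_smult_dim smult_mult_dim mult_mat_assoc)
    have rows: "mat_adjoint U * ?H z * V = J * (T_hat * ?Vh * ((z \<cdot>\<^sub>m N\<^sup>T - 1\<^sub>m n) * V))"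
      "mat_adjoint U * (T * E) = J * (T_hat * ?Vh * E)" for z
    proof -
      have "mat_adjoint U * ?H z * V = (mat_adjoint U * T) * ((z \<cdot>\<^sub>m N\<^sup>T - 1\<^sub>m n) * V)"
        unfolding HT(1) by (simp add: mult_mat_assoc)
      then show "mat_adjoint U * ?H z * V = J * (T_hat * ?Vh * ((z \<cdot>\<^sub>m N\<^sup>T - 1\<^sub>m n) * V))"
        unfolding UT by (simp add: mult_mat_assoc)
      have "mat_adjoint U * (T * E) = (mat_adjoint U * T) * E" by (simp add: mult_mat_assoc)
      then show "mat_adjoint U * (T * E) = J * (T_hat * ?Vh * E)" unfolding UT by (simp add: mult_mat_assoc)
    qed
    have cols: "mat_adjoint U * ?H z * V = (mat_adjoint U * (z \<cdot>\<^sub>m N - 1\<^sub>m n) * (U2 * T_hat)) * Jh"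
      "E\<^sup>T * (T * V) = (E\<^sup>T * (U2 * T_hat)) * Jh" for z
    proof -
      have "mat_adjoint U * ?H z * V = mat_adjoint U * (z \<cdot>\<^sub>m N - 1\<^sub>m n) * (T * V)"
        unfolding HT(2) by (simp add: mult_mat_assoc)
      then show "mat_adjoint U * ?H z * V = (mat_adjoint U * (z \<cdot>\<^sub>m N - 1\<^sub>m n) * (U2 * T_hat)) * Jh"
        unfolding TV by (simp add: mult_mat_assoc)
      show "E\<^sup>T * (T * V) = (E\<^sup>T * (U2 * T_hat)) * Jh" unfolding TV by (simp add: mult_mat_assoc)
    qed
    have "eval_mat M z $$ (i, j) = 0" for z
    proof (cases "i < k")
      case True
      have "(mat_adjoint U * ?H z * V) $$ (i, j) = 0" if "j < n"
        unfolding rows J_def using True kn that nk by (intro index_drop_cols_one_mult) simp_all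
      moreover have "(mat_adjoint U * (T * E)) $$ (i, j - n) = 0" if "\<not> j < n"
        unfolding rows J_def using True kn that ij' nk by (intro index_drop_cols_one_mult) simp_all
      ultimately show ?thesis using True kn ij' unfolding ev by (simp del: index_mult_mat(1))
    next
      case False
      then have j: "j < k" using ij by simp
      have "(mat_adjoint U * ?H z * V) $$ (i, j) = 0" if "i < n"
        unfolding cols Jh_def using j kn that nk by (intro index_mult_drop_rows_one) simp_all
      moreover have "(E\<^sup>T * (T * V)) $$ (i - n, j) = 0" if "\<not> i < n"
        unfolding cols Jh_def using j kn that ij' nk by (intro index_mult_drop_rows_one) simp_all
      ultimately show ?thesis using j kn ij' unfolding ev by (simp del: index_mult_mat(1))
    qed
    moreover have "dim_row M = n + m" "dim_col M = n + m" by (simp_all add: M)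
    ultimately have "poly (M $$ (i, j)) z = 0" for z
      using ij' by (simp add: eval_mat_def)
    then show ?thesis using poly_all_0_iff_0 by blast
  qed

  \<comment> \<open>Strong minimality and the transfer function\<close>
  have carrier_hat: "?A \<in> carrier_mat r r" "?B \<in> carrier_mat r m" "?C \<in> carrier_mat m r" "D \<in> carrier_mat m m"
    by (rule carrier_matI; simp)+
  have P10: "coeff_mat P 1 \<in> carrier_mat m m" "coeff_mat P 0 \<in> carrier_mat m m"
    by (rule carrier_matI; simp)+
  note minimal = strongly_minimal_four_block[OF carrier_hat eval_hat eval(4) P10 r]
  let ?F = "power_column m d"
  \<comment> \<open>\<open>?F\<close> solves the system for the full pencil. Its compression solves
    the truncated one, because \<open>T\<close> absorbs the projection
    \<open>V2 * ?Vh\<close>.\<close>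
  let ?X = "const_pmat ?Vh * ?F"
  have dimF [simp]: "dim_row ?F = n" "dim_col ?F = m" by (simp_all add: n_def)
  note dim_power_column [simp del]
  have "transfer_function r (four_block_mat ?A ?B ?C D) = rational_mat P"
  proof (rule transfer_function_eqI[OF carrier_hat _ minimal(2)])
    show "?X \<in> carrier_mat r m" by (rule carrier_matI) simp_all
    have T_X: "T * (V2 * (?Vh * Y)) = T * Y" if "dim_row Y = n" for Y
      using that arg_cong[OF T_proj, of "\<lambda>X. X * Y"] by (simp add: mult_mat_assoc)
    show "?A * ?X = - ?B"
    proof (rule pmat_eqI)
      fix z
      have "eval_mat (?A * ?X) z = ?Uh * ((z \<cdot>\<^sub>m (N * T) - T) * (V2 * (?Vh * eval_mat ?F z)))"
        by (simp add: eval_mat_mult eval_hat(1)[simplified] eval mult_mat_assoc)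
      also have "(z \<cdot>\<^sub>m (N * T) - T) * (V2 * (?Vh * eval_mat ?F z)) = (z \<cdot>\<^sub>m (N * T) - T) * eval_mat ?F z"
        by (simp add: minus_mult_distrib_dim smult_mult_dim mult_mat_assoc T_X)
      also have "\<dots> = T * ((z \<cdot>\<^sub>m N\<^sup>T - 1\<^sub>m n) * eval_mat ?F z)"
        by (simp add: mat_dim_simps shift)
      also have "(z \<cdot>\<^sub>m N\<^sup>T - 1\<^sub>m n) * eval_mat ?F z = (- z) \<cdot>\<^sub>m E"
        unfolding N_def E_def n_def by (rule shift_power_column[OF d])
      also have "?Uh * (T * ((- z) \<cdot>\<^sub>m E)) = (- z) \<cdot>\<^sub>m (?Uh * (T * E))"
        by (simp add: mult_smult_dim)
      also have "\<dots> = eval_mat (- ?B) z"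
        unfolding eval_mat_uminus eval_hat by (rule eq_matI) simp_all
      finally show "eval_mat (?A * ?X) z = eval_mat (- ?B) z" .
    qed simp_all
    show "D + ?C * ?X = P"
    proof (rule pmat_eqI)
      fix z
      have "eval_mat (D + ?C * ?X) z
        = z \<cdot>\<^sub>m coeff_mat P 1 + coeff_mat P 0 + z \<cdot>\<^sub>m (E\<^sup>T * (T * (V2 * (?Vh * eval_mat ?F z))))"
        by (simp add: eval_mat_add eval_mat_mult eval mult_mat_assoc smult_mult_dim)
      also have "\<dots> = z \<cdot>\<^sub>m coeff_mat P 1 + coeff_mat P 0 + z \<cdot>\<^sub>m (E\<^sup>T * (T * eval_mat ?F z))"
        by (simp add: T_X)
      also have "\<dots> = eval_mat P z"
        unfolding E_def T_def n_def by (rule hankel_power_column[OF P d deg])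
      finally show "eval_mat (D + ?C * ?X) z = eval_mat P z" .
    qed simp_all
  qed
  moreover have "rational_mat P \<in> carrier_mat m m" by (rule carrier_matI) simp_all
  ultimately have linearization: "strongly_minimal_linearization r m m (delete_leading k M) (rational_mat P)"
    using minimal(1) unfolding strongly_minimal_linearization_def L_hat by simp

  \<comment> \<open>The self-conjugate structure\<close>
  have "has_structure s (four_block_mat ?A ?B ?C D)"
    unfolding has_structure_iff
  proof
    fix z
    let ?w = "structure_twist s * cnj z" and ?e = "structure_sign s"
    define S where "S = twist_mat (structure_twist s) m d"
    note adj = mat_adjoint_eval_pencil_blocks[OF P d deg assms(4), of z,
        folded A_def B_def C_def D_def S_def]
    have [simp]: "dim_row S = n" "dim_col S = n" by (simp_all add: S_def n_def)
    \<comment> \<open>All four cases take the form \<open>U = S * V\<close>; in the Hermitian and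
      skew-Hermitian cases \<open>S\<close> is the identity.\<close>
    have "1\<^sub>m (m * (d - 1)) * V = V" unfolding n_def[symmetric] by (simp add: one_mult_dim)
    then have "U = S * V"
      using assms(11,12) by (cases s) (simp_all add: S_def twist_mat_one twist_mat_minus_one)
    then have U2: "U2 = S * V2" by (simp add: U2_def V2_def drop_cols_mult)
    \<comment> \<open>\<open>S\<close> is a self-adjoint involution, so the factors \<open>S\<close>
      that appear with the adjoints turn \<open>?Vh\<close> into \<open>?Uh\<close> and
      \<open>U2\<close> into \<open>V2\<close>.\<close>
    have SS: "S * S = 1\<^sub>m n"
      unfolding S_def n_def by (rule twist_mat_square[OF structure_twist_square])
    have V2: "S * U2 = V2" unfolding U2 by (simp add: SS one_mult_dim flip: mult_mat_assoc)
    have Uh: "?Vh * S = ?Uh"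
    proof -
      have "mat_adjoint S = S" unfolding S_def by (rule mat_adjoint_twist[OF cnj_structure_twist])
      then show ?thesis unfolding U2 by (simp add: mat_adjoint_mult)
    qed
    have "mat_adjoint (eval_mat ?A z) = ?Vh * mat_adjoint (eval_mat A z) * U2"
      by (simp add: eval_mat_mult mat_adjoint_mult mult_mat_assoc)
    also have "\<dots> = ?e \<cdot>\<^sub>m ((?Vh * S) * eval_mat A ?w * (S * U2))"
      unfolding adj by (simp add: mult_mat_assoc smult_mult_dim mult_smult_dim)
    also have "\<dots> = ?e \<cdot>\<^sub>m eval_mat ?A ?w"
      unfolding Uh V2 by (simp add: eval_mat_mult)
    finally have A: "mat_adjoint (eval_mat ?A z) = ?e \<cdot>\<^sub>m eval_mat ?A ?w" .
    have "mat_adjoint (eval_mat ?C z) = ?Vh * mat_adjoint (eval_mat C z)"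
      by (simp add: eval_mat_mult mat_adjoint_mult)
    also have "\<dots> = ?e \<cdot>\<^sub>m ((?Vh * S) * eval_mat B ?w)"
      unfolding adj by (simp add: mult_mat_assoc mult_smult_dim)
    finally have C: "mat_adjoint (eval_mat ?C z) = ?e \<cdot>\<^sub>m eval_mat ?B ?w"
      unfolding Uh by (simp add: eval_mat_mult)
    have "mat_adjoint (eval_mat ?B z) = mat_adjoint (eval_mat B z) * U2"
      by (simp add: eval_mat_mult mat_adjoint_mult)
    also have "\<dots> = ?e \<cdot>\<^sub>m (eval_mat C ?w * (S * U2))"
      unfolding adj by (simp add: mult_mat_assoc smult_mult_dim)
    finally have B: "mat_adjoint (eval_mat ?B z) = ?e \<cdot>\<^sub>m eval_mat ?C ?w"
      unfolding V2 by (simp add: eval_mat_mult)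
    \<comment> \<open>The adjoint exchanges the off-diagonal blocks, so the adjoint of
      \<open>?C\<close> is matched with \<open>?B\<close> and conversely.\<close>
    have "mat_adjoint (eval_mat (four_block_mat ?A ?B ?C D) z)
      = four_block_mat (mat_adjoint (eval_mat ?A z)) (mat_adjoint (eval_mat ?C z))
          (mat_adjoint (eval_mat ?B z)) (mat_adjoint (eval_mat D z))"
      by (subst eval_four_block_mat, simp_all) (rule mat_adjoint_four_block_mat, simp_all)
    also have "\<dots> = ?e \<cdot>\<^sub>m four_block_mat (eval_mat ?A ?w) (eval_mat ?B ?w) (eval_mat ?C ?w) (eval_mat D ?w)"
      unfolding A B C adj
      by (rule smult_four_block_mat[symmetric]; rule carrier_matI; simp)
    also have "four_block_mat (eval_mat ?A ?w) (eval_mat ?B ?w) (eval_mat ?C ?w) (eval_mat D ?w)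
      = eval_mat (four_block_mat ?A ?B ?C D) ?w"
      by (rule eval_four_block_mat[symmetric]) simp_all
    finally show "mat_adjoint (eval_mat (four_block_mat ?A ?B ?C D) z)
      = ?e \<cdot>\<^sub>m eval_mat (four_block_mat ?A ?B ?C D) ?w" .
  qed
  then show ?thesis
    using zeros linearization unfolding Let_def L_hat[symmetric] M_def k_def n_def by blast
qed

end
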